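(* Let $n\ge1$, let $a_1,\dots,a_{n-1},b_1,\dots,b_{n-1}$ be complex parameters of modulus strictly less than $1$, and define the $q$-difference operator, acting on functions of $x_1,\dots,x_n$, $$\overline{\mathfrak{D}}_{\boldsymbol a}=\sum_{i=1}^n\ \prod_{r=1}^{n-1}(1-a_r/x_i)\prod_{\substack{j=1\\ j\ne i}}^n\frac1{1-x_j/x_i}\ T_{q^{-1},x_i},$$ where $T_{q^{-1},x_i}$ replaces $x_i$ by $q^{-1}x_i$. Then for every $\lambda\in\mathbb{Y}_n$, $$\overline{\mathfrak{D}}_{\boldsymbol a}\,\mathsf f_\lambda(x_1,\dots,x_n|a_1,\dots,a_{n-1};b_1,\dots,b_{n-1})=q^{-\lambda_1}\,\mathsf f_\lambda(x_1,\dots,x_n|a_1,\dots,a_{n-1};b_1,\dots,b_{n-1}).$$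
   Context: Let $q\in\mathbb{C}$ with $|q|<1$ ($q\neq0$, so that $q^{-1}$ makes sense), and $(z;q)_k=\prod_{i=0}^{k-1}(1-zq^i)$ for $k\in\mathbb{Z}_{\ge0}$. $\mathbb{Y}_n$ is the set of integer partitions $\lambda=(\lambda_1\ge\dots\ge\lambda_n\ge0)$ with at most $n$ nonzero parts, with $\lambda_i=0$ for $i>n$; $|\lambda|=\sum_i\lambda_i$. For partitions, $\mu\preceq\lambda$ means $\lambda_i\ge\mu_i\ge\lambda_{i+1}$ for all $i\ge1$. Spin $q$-Whittaker polynomials: let $c_1,\dots,c_n,d_1,\dots,d_n$ be complex parameters of modulus $<1$. For $\lambda\in\mathbb{Y}_n$, $\mu\in\mathbb{Y}_{n-1}$ set $$\mathbb{F}_{\lambda/\mu}(x|c_1,\dots,c_n;d_1,\dots,d_n)=\mathbf 1_{\mu\preceq\lambda}\,x^{|\lambda|-|\mu|}\prod_{r=1}^n\frac{(c_r/x;q)_{\lambda_r-\mu_r}(xd_r;q)_{\mu_r-\lambda_{r+1}}(q;q)_{\lambda_r-\lambda_{r+1}}}{(q;q)_{\lambda_r-\mu_r}(q;q)_{\mu_r-\lambda_{r+1}}(c_rd_r;q)_{\lambda_r-\lambda_{r+1}}}.$$ Define recursively, starting from $\mathbb{F}_\varnothing=1$ in zero variables, $$\mathbb{F}_\lambda(x_1,\dots,x_n|c_1,\dots,c_n;d_1,\dots,d_n)=\sum_{\mu\in\mathbb{Y}_{n-1},\,\mu\preceq\lambda}\mathbb{F}_\mu(x_1,\dots,x_{n-1}|c_2,\dots,c_n;d_1,\dots,d_{n-1})\,\mathbb{F}_{\lambda/\mu}(x_n|c_1,\dots,c_n;d_1,\dots,d_n).$$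 These are polynomials, known to be symmetric in $x_1,\dots,x_n$. Set $$\mathsf f_\lambda(x_1,\dots,x_n|c_1,\dots,c_{n-1};d_1,\dots,d_{n-1})=\mathbb{F}_\lambda(x_1,\dots,x_n|c_1,\dots,c_{n-1},0;d_1,\dots,d_n),$$ which does not depend on $d_n$. *)

theory Defs
  imports Complex_Main
begin

definition qpoch :: "complex \<Rightarrow> complex \<Rightarrow> nat \<Rightarrow> complex" where
  "qpoch z q k = (\<Prod>i<k. 1 - z * q ^ i)"

text \<open>Partitions, alphabets and parameter families are functions on \<open>nat\<close> read at the
  indices \<open>1, 2, \<dots>\<close>.  The unused index \<open>0\<close> of a partition is pinned to \<open>0\<close>, so that each
  partition has exactly one representative (otherwise the sum over \<open>mu\<close> below would be infinite).\<close>

definition partitions :: "nat \<Rightarrow> (nat \<Rightarrow> nat) set" where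
  "partitions n = {lam. lam 0 = 0 \<and> (\<forall>i\<ge>1. lam (i + 1) \<le> lam i) \<and> (\<forall>i>n. lam i = 0)}"

definition psize :: "(nat \<Rightarrow> nat) \<Rightarrow> nat" where
  "psize lam = (\<Sum>i | lam i \<noteq> 0. lam i)"

definition interlaces :: "(nat \<Rightarrow> nat) \<Rightarrow> (nat \<Rightarrow> nat) \<Rightarrow> bool" where
  "interlaces mu lam \<longleftrightarrow> (\<forall>i\<ge>1. mu i \<le> lam i \<and> lam (i + 1) \<le> mu i)"

text \<open>The subtractions on \<open>nat\<close> do not truncate when \<open>interlaces mu lam\<close> holds.
  Because of the terms \<open>c r / x\<close>, the value is meaningful for \<open>x \<noteq> 0\<close> only.\<close>

definition sqW_skew ::
  "complex \<Rightarrow> nat \<Rightarrow> (nat \<Rightarrow> nat) \<Rightarrow> (nat \<Rightarrow> nat) \<Rightarrow> complex \<Rightarrow>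
    (nat \<Rightarrow> complex) \<Rightarrow> (nat \<Rightarrow> complex) \<Rightarrow> complex" where
  "sqW_skew q n lam mu x c d =
    (if interlaces mu lam then
       x ^ (psize lam - psize mu) *
       (\<Prod>r = 1..n.
          (qpoch (c r / x) q (lam r - mu r) * qpoch (x * d r) q (mu r - lam (r + 1)) *
             qpoch q q (lam r - lam (r + 1))) /
          (qpoch q q (lam r - mu r) * qpoch q q (mu r - lam (r + 1)) *
             qpoch (c r * d r) q (lam r - lam (r + 1))))
     else 0)"

fun sqW ::
  "complex \<Rightarrow> nat \<Rightarrow> (nat \<Rightarrow> nat) \<Rightarrow> (nat \<Rightarrow> complex) \<Rightarrow>
    (nat \<Rightarrow> complex) \<Rightarrow> (nat \<Rightarrow> complex) \<Rightarrow> complex" where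
  "sqW q 0 lam x c d = 1"
| "sqW q (Suc n) lam x c d =
    (\<Sum>mu | mu \<in> partitions n \<and> interlaces mu lam.
       sqW q n mu x (\<lambda>i. c (i + 1)) d * sqW_skew q (Suc n) lam mu (x (Suc n)) c d)"

text \<open>The values \<open>c n\<close> and \<open>d n\<close> do not matter: see \<open>sqW_f_cong\<close>.\<close>

definition sqW_f ::
  "complex \<Rightarrow> nat \<Rightarrow> (nat \<Rightarrow> nat) \<Rightarrow> (nat \<Rightarrow> complex) \<Rightarrow>
    (nat \<Rightarrow> complex) \<Rightarrow> (nat \<Rightarrow> complex) \<Rightarrow> complex" where
  "sqW_f q n lam x c d = sqW q n lam x (c(n := 0)) d"

definition qdiff_op ::
  "complex \<Rightarrow> nat \<Rightarrow> (nat \<Rightarrow> complex) \<Rightarrow>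
    ((nat \<Rightarrow> complex) \<Rightarrow> complex) \<Rightarrow> (nat \<Rightarrow> complex) \<Rightarrow> complex" where
  "qdiff_op q n a f x =
    (\<Sum>i = 1..n. (\<Prod>r = 1..n - 1. 1 - a r / x i) *
       (\<Prod>j \<in> {1..n} - {i}. 1 / (1 - x j / x i)) * f (x(i := inverse q * x i)))"

lemma finite_interlacing: "finite {mu. mu \<in> partitions n \<and> interlaces mu lam}"
proof (rule finite_subset)
  let ?M = "Max (lam ` {0..n})"
  show "finite {mu. \<forall>i. (i \<in> {0..n} \<longrightarrow> mu i \<in> {0..?M}) \<and> (i \<notin> {0..n} \<longrightarrow> mu i = 0)}"
    by (rule finite_set_of_finite_funs) auto
  show "{mu. mu \<in> partitions n \<and> interlaces mu lam} \<subseteq>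
    {mu. \<forall>i. (i \<in> {0..n} \<longrightarrow> mu i \<in> {0..?M}) \<and> (i \<notin> {0..n} \<longrightarrow> mu i = 0)}"
  proof (clarify, intro conjI impI)
    fix mu i
    assume mu: "mu \<in> partitions n" "interlaces mu lam"
    show "mu i \<in> {0..?M}" if "i \<in> {0..n}"
    proof (cases "i = 0")
      case True
      then show ?thesis using mu(1) by (simp add: partitions_def)
    next
      case False
      then have "mu i \<le> lam i" using mu(2) by (simp add: interlaces_def)
      also have "lam i \<le> ?M" using that by (intro Max_ge) auto
      finally show ?thesis by simp
    qed
    show "mu i = 0" if "i \<notin> {0..n}"
      using that mu(1) by (simp add: partitions_def)
  qed
qed

lemma sqW_cong:
  assumes "\<And>r. r \<in> {1..n} \<Longrightarrow> c r = c' r" "\<And>r. r \<in> {1..<n} \<Longrightarrow> d r = d' r" "c n = 0" "c' n = 0"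
  shows "sqW q n lam x c d = sqW q n lam x c' d'"
  using assms
proof (induction n arbitrary: lam c c')
  case 0
  then show ?case by simp
next
  case (Suc n)
  have "sqW q n mu x (\<lambda>i. c (i + 1)) d = sqW q n mu x (\<lambda>i. c' (i + 1)) d'" for mu
    using Suc.prems by (intro Suc.IH) auto
  moreover have "sqW_skew q (Suc n) lam mu (x (Suc n)) c d = sqW_skew q (Suc n) lam mu (x (Suc n)) c' d'"
    if "mu \<in> partitions n" for mu
  proof -
    have "mu (Suc n) = 0" using that by (simp add: partitions_def)
    then show ?thesis
      using Suc.prems by (simp add: sqW_skew_def qpoch_def)
  qed
  ultimately show ?case by (auto intro!: sum.cong)
qed

lemma sqW_f_cong:
  assumes "\<And>r. r \<in> {1..<n} \<Longrightarrow> c r = c' r" "\<And>r. r \<in> {1..<n} \<Longrightarrow> d r = d' r"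
  shows "sqW_f q n lam x c d = sqW_f q n lam x c' d'"
  unfolding sqW_f_def using assms by (intro sqW_cong) auto

end

theory Submission
  imports Defs
begin

text \<open>
  The proof is an induction on the number of variables along the branching rule
  \<open>F_lam(x_1, ..., x_n) = (SUM mu. F_mu(x_1, ..., x_{n-1}) F_{lam/mu}(x_n))\<close>, in which the smaller
  polynomials carry the shifted parameters \<open>c_2, c_3, ...\<close>.  Write \<open>z = x_n\<close>, let \<open>f_mu\<close> be the
  polynomials in the other variables, \<open>P\<close> the product of the \<open>z - x_j\<close> over \<open>j < n\<close>, \<open>T_i\<close> the
  shift of \<open>x_i\<close>, and \<open>D = (SUM i. A_i T_i)\<close> the difference operator in \<open>n - 1\<close> variables.

  For \<open>i < n\<close> the coefficient of \<open>T_i\<close> in the operator in \<open>n\<close> variables is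
  \<open>A_i (x_i - c_1) / (x_i - z)\<close>, so the induction hypothesis for \<open>D\<close> does not suffice: the action of
  \<open>E = (SUM i. A_i / (x_i - z) T_i)\<close> on \<open>f_mu\<close> has to be known as well.  It is obtained from a
  commutation: \<open>T_i\<close> multiplies \<open>P\<close> by \<open>1/q - (1 - 1/q) z / (x_i - z)\<close>, whence
  \<open>D P = P (1/q D - (1 - 1/q) z E)\<close>.  Therefore \<open>E\<close> is determined by \<open>D\<close> and by the expansion of
  \<open>P f_mu\<close>, which is a Pieri rule (lemma \<open>pieri\<close>): \<open>P f_mu\<close> is a combination of the \<open>f_nu\<close> with
  \<open>nu - mu\<close> a vertical strip.  As \<open>D\<close> multiplies \<open>f_nu\<close> by \<open>q^(-nu_1)\<close>, and \<open>nu_1\<close> is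
  \<open>mu_1\<close> or \<open>mu_1 + 1\<close>, the terms with \<open>nu_1 = mu_1 + 1\<close> cancel, and \<open>z P E f_mu\<close> is \<open>- q^(-mu_1)\<close> times the part
  \<open>nu_1 = mu_1\<close> of the Pieri expansion.  After this substitution the eigenrelation is a linear relation
  between the \<open>f_kap\<close> that holds coefficient by coefficient (lemma \<open>eigen_coefficient\<close>).

  Both the Pieri rule and this coefficient identity are statements about chains of two by two matrices.
  The skew polynomial \<open>F_{lam/mu}(x)\<close> factorises over the rows \<open>r\<close>: of the \<open>lam_r - lam_{r+1}\<close>
  particles at site \<open>r\<close>, \<open>lam_r - mu_r\<close> hop to site \<open>r - 1\<close>, with the weight of the \<open>q\<close>-Hahn
  process.  A vertical strip is a sequence of bits, one for each row, and its Pieri coefficient is a product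
  of weights that depend on two consecutive bits.  Hence summing over strips, before or after a branching
  step, amounts to multiplying two by two matrices \<open>M_r\<close> or \<open>N_r\<close> along the rows, and a gauge matrix
  \<open>G_r\<close> intertwines the two chains, \<open>N_r G_{r+1} = G_r M_r\<close> (lemma \<open>intertwine\<close>).  Both column sums
  of \<open>G_r\<close> are \<open>z - x\<close>: this proves the Pieri rule by induction on the number of variables, and at
  \<open>x = z\<close>, where \<open>G_r\<close> has rank one, it collapses the chain to a product, in which the skew polynomial
  at \<open>z / q\<close> is recognised (lemma \<open>tail_degenerate\<close>).
\<close>

section \<open>Skew polynomials as products of hopping weights\<close>

lemma qpoch_0 [simp]: "qpoch z q 0 = 1"
  by (simp add: qpoch_def)

lemma qpoch_zero: "qpoch 0 q k = 1"
  by (simp add: qpoch_def)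

lemma qpoch_Suc: "qpoch z q (Suc k) = qpoch z q k * (1 - z * q ^ k)"
  by (simp add: qpoch_def)

lemma qpoch_Suc_left: "qpoch z q (Suc k) = (1 - z) * qpoch (z * q) q k"
  unfolding qpoch_def by (subst prod.lessThan_Suc_shift) (simp add: mult.assoc)

lemma qpoch_nonzero:
  assumes "\<And>i. z * q ^ i \<noteq> 1"
  shows "qpoch z q k \<noteq> 0"
  using assms by (simp add: qpoch_def)

text \<open>
  Times \<open>d^k\<close>, this is the jump distribution of the \<open>q\<close>-Hahn process with parameters \<open>x d\<close> and
  \<open>c d\<close>: the weight with which \<open>k\<close> of the \<open>m\<close> particles at a site hop.  The arguments are integers, with value \<open>0\<close> outside \<open>0 \<le> k \<le> m\<close>, so that
  the contiguity relations hold at the boundary and sums over strips need no side conditions.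
\<close>

definition hop :: "complex \<Rightarrow> complex \<Rightarrow> complex \<Rightarrow> complex \<Rightarrow> int \<Rightarrow> int \<Rightarrow> complex" where
  "hop q x c d k m =
    (if 0 \<le> k \<and> k \<le> m then
       x ^ nat k * ((qpoch (c / x) q (nat k) * qpoch (x * d) q (nat (m - k)) * qpoch q q (nat m)) /
         (qpoch q q (nat k) * qpoch q q (nat (m - k)) * qpoch (c * d) q (nat m)))
     else 0)"

lemma hop_nat:
  "hop q x c d (int a) (int a + int b) =
     x ^ a * ((qpoch (c / x) q a * qpoch (x * d) q b * qpoch q q (a + b)) /
       (qpoch q q a * qpoch q q b * qpoch (c * d) q (a + b)))"
  by (simp add: hop_def nat_add_distrib)

lemma hop_outside: "k < 0 \<or> m < k \<Longrightarrow> hop q x c d k m = 0"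
  by (auto simp: hop_def)

definition skew_prod ::
  "complex \<Rightarrow> nat \<Rightarrow> (nat \<Rightarrow> nat) \<Rightarrow> (nat \<Rightarrow> nat) \<Rightarrow> complex \<Rightarrow>
    (nat \<Rightarrow> complex) \<Rightarrow> (nat \<Rightarrow> complex) \<Rightarrow> complex" where
  "skew_prod q n lam mu x c d =
     (\<Prod>r=1..n. hop q x (c r) (d r) (int (lam r) - int (mu r)) (int (lam r) - int (lam (Suc r))))"

lemma psize_eq_sum:
  assumes "lam 0 = 0" "\<And>i. i > n \<Longrightarrow> lam i = 0"
  shows "psize lam = (\<Sum>i=1..n. lam i)"
  unfolding psize_def
proof (rule sum.mono_neutral_left)
  show "{i. lam i \<noteq> 0} \<subseteq> {1..n}"
    using assms by (metis (mono_tags) atLeastAtMost_iff less_one mem_Collect_eq not_le subsetI)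
qed auto

lemma sqW_skew_eq_skew_prod:
  assumes "lam 0 = 0" "\<And>i. i > n \<Longrightarrow> lam i = 0" "mu 0 = 0" "\<And>i. i > n \<Longrightarrow> mu i = 0"
    and int: "interlaces mu lam"
  shows "sqW_skew q n lam mu x c d = skew_prod q n lam mu x c d"
proof -
  have le: "mu r \<le> lam r" "lam (Suc r) \<le> mu r" if "r \<in> {1..n}" for r
    using int that by (auto simp: interlaces_def)
  have "psize lam - psize mu = (\<Sum>r=1..n. lam r - mu r)"
    using psize_eq_sum[of lam n] psize_eq_sum[of mu n] assms(1-4) le(1)
    by (subst sum_subtractf_nat) simp_all
  then have p: "x ^ (psize lam - psize mu) = (\<Prod>r=1..n. x ^ (lam r - mu r))"
    by (simp add: power_sum)
  show ?thesis
    unfolding sqW_skew_def skew_prod_def p if_P[OF int] prod.distrib[symmetric]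
  proof (intro prod.cong refl)
    fix r assume r: "r \<in> {1..n}"
    have e: "int (lam r) - int (mu r) = int (lam r - mu r)"
      "int (lam r) - int (lam (Suc r)) = int (lam r - mu r) + int (mu r - lam (r + 1))"
      and s: "lam r - mu r + (mu r - lam (r + 1)) = lam r - lam (r + 1)"
      using le[OF r] by auto
    show "x ^ (lam r - mu r) * (qpoch (c r / x) q (lam r - mu r) * qpoch (x * d r) q (mu r - lam (r + 1)) *
          qpoch q q (lam r - lam (r + 1)) /
        (qpoch q q (lam r - mu r) * qpoch q q (mu r - lam (r + 1)) * qpoch (c r * d r) q (lam r - lam (r + 1)))) =
        hop q x (c r) (d r) (int (lam r) - int (mu r)) (int (lam r) - int (lam (Suc r)))"
      unfolding e hop_nat s ..
  qed
qed

text \<open>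
  The vanishing of the hopping weights encodes interlacing, so that sums over interlacing partitions may be
  taken over any larger set of functions, such as a box.
\<close>

lemma skew_prod_nonzeroD:
  assumes nz: "skew_prod q (Suc n) lam mu x c d \<noteq> 0"
    and "\<And>i. i > Suc n \<Longrightarrow> lam i = 0" "mu 0 = 0" "\<And>i. i > n \<Longrightarrow> mu i = 0"
  shows "mu \<in> partitions n" "interlaces mu lam"
proof -
  have "mu r \<le> lam r \<and> lam (r + 1) \<le> mu r" if "r \<ge> 1" for r
  proof (cases "r \<le> Suc n")
    case True
    then have "hop q x (c r) (d r) (int (lam r) - int (mu r)) (int (lam r) - int (lam (Suc r))) \<noteq> 0"
      using nz that by (auto simp: skew_prod_def simp del: prod.cl_ivl_Suc)
    then have "\<not> (int (lam r) - int (mu r) < 0 \<or>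
        int (lam r) - int (lam (Suc r)) < int (lam r) - int (mu r))"
      using hop_outside by blast
    then show ?thesis by simp
  next
    case False
    then show ?thesis using assms by simp
  qed
  then show "interlaces mu lam" by (simp add: interlaces_def)
  then show "mu \<in> partitions n"
    using assms(3,4) by (auto simp: partitions_def interlaces_def intro: order_trans)
qed

section \<open>Strips and chains of two by two matrices\<close>

text \<open>
  The contribution of a row to a Pieri coefficient: \<open>e\<close> and \<open>f\<close> say whether the strip meets this row and
  the next one, and \<open>Q\<close> is \<open>q\<close> to the number of particles at the site.  The factor \<open>1 - Q\<close> forbids
  strips whose addition would not give a partition.
\<close>

definition pieri_wt :: "complex \<Rightarrow> complex \<Rightarrow> complex \<Rightarrow> bool \<Rightarrow> bool \<Rightarrow> complex \<Rightarrow> complex" where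
  "pieri_wt z c d e f Q =
    (if e then (if f then - (1 - d * z * Q) else - (1 - c * d * Q))
     else (if f then z * (1 - Q) else z - c * Q))"

definition add_strip :: "(nat \<Rightarrow> nat) \<Rightarrow> nat set \<Rightarrow> nat \<Rightarrow> nat" where
  "add_strip lam S i = lam i + of_bool (i \<in> S)"

definition pieri_coef ::
  "complex \<Rightarrow> complex \<Rightarrow> nat \<Rightarrow> (nat \<Rightarrow> nat) \<Rightarrow>
    (nat \<Rightarrow> complex) \<Rightarrow> (nat \<Rightarrow> complex) \<Rightarrow> nat set \<Rightarrow> complex" where
  "pieri_coef q z n lam c d S =
     (\<Prod>r=1..n. pieri_wt z (c r) (d r) (r \<in> S) (Suc r \<in> S) (q powi (int (lam r) - int (lam (Suc r)))))"

text \<open>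
  To be taken at \<open>K = q^(lam r - kap r)\<close> and \<open>c = c r\<close> for branching from \<open>lam\<close> to \<open>kap\<close>.  The first column is
  read off at the last row of the chain; the second one is then forced by the intertwining relation.  The two
  entries of each column add up to \<open>z - x\<close>.
\<close>

definition gauge :: "complex \<Rightarrow> complex \<Rightarrow> complex \<Rightarrow> complex \<Rightarrow> complex \<Rightarrow> bool \<Rightarrow> bool \<Rightarrow> complex" where
  "gauge q z x c K e f =
    (if e then (if f then z * (q * K) - x else - (x - c * K))
     else (if f then z * (1 - q * K) else z - c * K))"

text \<open>
  The rows of the two ways from \<open>lam\<close> to \<open>kap\<close>, where \<open>m r = lam r - lam (r + 1)\<close> and
  \<open>k r = lam r - kap r\<close>.  In the first one, branching leads to \<open>mu\<close> and then a strip is added to obtain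
  \<open>kap\<close>, so that \<open>lam r - mu r = k r + e\<close> and the Pieri weight takes its particles from \<open>mu\<close> and its
  parameters from the polynomials with one variable less.  In the second one, the strip is added to \<open>lam\<close>
  before branching to \<open>kap\<close>.
\<close>

definition branch_pieri_mat ::
  "complex \<Rightarrow> complex \<Rightarrow> complex \<Rightarrow> (nat \<Rightarrow> complex) \<Rightarrow> (nat \<Rightarrow> complex) \<Rightarrow>
    (nat \<Rightarrow> int) \<Rightarrow> (nat \<Rightarrow> int) \<Rightarrow> nat \<Rightarrow> bool \<Rightarrow> bool \<Rightarrow> complex" where
  "branch_pieri_mat q z x c d k m r e f =
     hop q x (c r) (d r) (k r + of_bool e) (m r) *
     pieri_wt z (c (Suc r)) (d r) e f (q powi (m r - k r + k (Suc r) + of_bool f - of_bool e))"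

definition pieri_branch_mat ::
  "complex \<Rightarrow> complex \<Rightarrow> complex \<Rightarrow> (nat \<Rightarrow> complex) \<Rightarrow> (nat \<Rightarrow> complex) \<Rightarrow>
    (nat \<Rightarrow> int) \<Rightarrow> (nat \<Rightarrow> int) \<Rightarrow> nat \<Rightarrow> bool \<Rightarrow> bool \<Rightarrow> complex" where
  "pieri_branch_mat q z x c d k m r e f =
     pieri_wt z (c r) (d r) e f (q powi m r) *
     hop q x (c r) (d r) (k r + of_bool e) (m r + of_bool e - of_bool f)"

text \<open>
  The entry \<open>e\<close> of the product of \<open>l\<close> consecutive matrices, starting with the one at row \<open>r\<close>, applied
  to the first basis vector: a strip does not extend below the last row.
\<close>

fun tail :: "(nat \<Rightarrow> bool \<Rightarrow> bool \<Rightarrow> complex) \<Rightarrow> nat \<Rightarrow> nat \<Rightarrow> bool \<Rightarrow> complex" where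
  "tail g r 0 e = of_bool (\<not> e)"
| "tail g r (Suc l) e = g r e False * tail g (Suc r) l False + g r e True * tail g (Suc r) l True"

text \<open>
  Transfer matrix summation: a strip is a subset of the rows, and its weight couples only neighbouring rows.
  The factor \<open>u\<close> lets the strip be weighted by its effect on the first part.
\<close>

lemma sum_subsets_eq_tail:
  "(\<Sum>S\<in>Pow {r..<r + l}. u (r \<in> S) * (\<Prod>i\<in>{r..<r + l}. g i (i \<in> S) (Suc i \<in> S))) =
     u False * tail g r l False + u True * tail g r l True"
proof (induction l arbitrary: r u)
  case 0
  then show ?case by simp
next
  case (Suc l)
  define X where "X = {Suc r..<Suc r + l}"
  define F where "F S = (\<Prod>i\<in>X. g i (i \<in> S) (Suc i \<in> S))" for S
  have ins: "{r..<r + Suc l} = insert r X" by (auto simp: X_def)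
  have r: "r \<notin> X" and fin: "finite X" by (simp_all add: X_def)
  have inj: "inj_on (insert r) (Pow X)"
    using r by (intro inj_onI) (metis PowD insert_ident subsetD)
  have disj: "Pow X \<inter> insert r ` Pow X = {}" using r by auto
  have F: "F (insert r S) = F S" for S
    unfolding F_def by (intro prod.cong) (auto simp: X_def)
  have split: "(\<Prod>i\<in>insert r X. g i (i \<in> S) (Suc i \<in> S)) = g r (r \<in> S) (Suc r \<in> S) * F S" for S
    using r fin by (simp add: F_def)
  have no: "r \<notin> S" if "S \<in> Pow X" for S using that r by auto
  have "(\<Sum>S\<in>Pow (insert r X). u (r \<in> S) * (g r (r \<in> S) (Suc r \<in> S) * F S)) =
     (\<Sum>S\<in>Pow X. u (r \<in> S) * (g r (r \<in> S) (Suc r \<in> S) * F S)) +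
     (\<Sum>S\<in>Pow X. u True * (g r True (Suc r \<in> S) * F S))"
    unfolding Pow_insert using fin
    by (subst sum.union_disjoint[OF _ _ disj]) (simp_all add: sum.reindex[OF inj] F)
  also have "(\<Sum>S\<in>Pow X. u (r \<in> S) * (g r (r \<in> S) (Suc r \<in> S) * F S)) =
     (\<Sum>S\<in>Pow X. u False * (g r False (Suc r \<in> S) * F S))"
    by (intro sum.cong) (simp_all add: no)
  also have "(\<Sum>S\<in>Pow X. u False * (g r False (Suc r \<in> S) * F S)) +
     (\<Sum>S\<in>Pow X. u True * (g r True (Suc r \<in> S) * F S)) =
     u False * tail g r (Suc l) False + u True * tail g r (Suc l) True"
    using Suc.IH[of "\<lambda>f. u False * g r False f" "Suc r"] Suc.IH[of "\<lambda>f. u True * g r True f" "Suc r"]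
    unfolding X_def[symmetric] F_def[symmetric] by (simp add: algebra_simps)
  finally show ?case unfolding ins split .
qed

definition box :: "nat \<Rightarrow> nat \<Rightarrow> (nat \<Rightarrow> nat) set" where
  "box n L = {mu. mu 0 = 0 \<and> (\<forall>i>n. mu i = 0) \<and> (\<forall>i. mu i \<le> L)}"

lemma finite_box: "finite (box n L)"
proof (rule finite_subset)
  show "box n L \<subseteq> {mu. \<forall>i. (i \<in> {0..n} \<longrightarrow> mu i \<in> {0..L}) \<and> (i \<notin> {0..n} \<longrightarrow> mu i = 0)}"
    by (auto simp: box_def)
qed (rule finite_set_of_finite_funs; simp)

text \<open>
  The condition that no denominator \<open>(c_i d_j; q)_k\<close> vanishes, also at the later stages of the recursion,
  where the shift of \<open>c\<close> pairs \<open>d_j\<close> with every \<open>c_i\<close>, \<open>i \<ge> j\<close>.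
\<close>

definition nonresonant :: "complex \<Rightarrow> nat \<Rightarrow> (nat \<Rightarrow> complex) \<Rightarrow> (nat \<Rightarrow> complex) \<Rightarrow> bool" where
  "nonresonant q n c d \<longleftrightarrow> (\<forall>i\<in>{1..n}. \<forall>j\<in>{1..i}. \<forall>e. c i * d j * q ^ e \<noteq> 1)"

lemma nonresonant_shift: "nonresonant q (Suc n) c d \<Longrightarrow> nonresonant q n (\<lambda>i. c (Suc i)) d"
  by (auto simp: nonresonant_def)

lemma partitions_le_first:
  assumes "lam \<in> partitions n"
  shows "lam i \<le> lam 1"
proof (induction i)
  case 0
  then show ?case using assms by (simp add: partitions_def)
next
  case (Suc i)
  show ?case
  proof (cases "i = 0")
    case False
    then have "lam (Suc i) \<le> lam i" using assms by (simp add: partitions_def)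
    then show ?thesis using Suc by linarith
  qed simp
qed

lemma sqW_x_cong:
  "(\<And>i. i \<in> {1..n} \<Longrightarrow> x i = y i) \<Longrightarrow> sqW q n lam x c d = sqW q n lam y c d"
proof (induction n arbitrary: lam c)
  case (Suc n)
  have "sqW q n mu x c' d = sqW q n mu y c' d" for mu c'
    using Suc.prems by (intro Suc.IH) auto
  moreover have "x (Suc n) = y (Suc n)" using Suc.prems by simp
  ultimately show ?case by simp
qed simp

section \<open>Contiguity relations of the hopping weights\<close>

context
  fixes q :: complex
  assumes q0: "q \<noteq> 0" and q1: "norm q < 1"
begin

lemma q_pow_ne_1: "q * q ^ i \<noteq> 1"
proof -
  have "norm (q ^ Suc i) < 1"
    unfolding norm_power by (rule power_Suc_less_one) (use q0 q1 in auto)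
  then show ?thesis by auto
qed

lemma qpoch_q_nonzero: "qpoch q q k \<noteq> 0"
  using q_pow_ne_1 by (rule qpoch_nonzero)

text \<open>
  Adding one particle to the site, which stays there in the first lemma and hops in the second one, extends each
  \<open>q\<close>-Pochhammer symbol by at most one factor.  The contiguity relations between hopping weights with
  the same \<open>x\<close> are linear combinations of these two.
\<close>

lemma hop_step_stay:
  assumes cd: "\<And>i. c * d * q ^ i \<noteq> 1" and "m \<ge> 0"
  shows "hop q x c d k (m + 1) * (1 - q powi (m + 1 - k)) * (1 - c * d * q powi m) =
    hop q x c d k m * (1 - x * d * q powi (m - k)) * (1 - q powi (m + 1))"
proof -
  consider "k < 0" | "k > m + 1" | "k = m + 1" | "0 \<le> k" "k \<le> m" by linarith
  then show ?thesis
  proof cases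
    case 4
    define a b where "a = nat k" and "b = nat (m - k)"
    have ab: "k = int a" "m = int a + int b" using 4 by (auto simp: a_def b_def)
    have m1: "int a + int b + 1 = int a + int (Suc b)" by simp
    have e: "m + 1 - k = int (Suc b)" "m = int (a + b)" "m - k = int b" "m + 1 = int (Suc (a + b))"
      using ab by auto
    have p: "q powi (m + 1 - k) = q * q ^ b" "q powi m = q ^ (a + b)" "q powi (m - k) = q ^ b"
      "q powi (m + 1) = q * q ^ (a + b)"
      by (subst e; simp only: power_int_of_nat power_Suc)+
    have h1: "hop q x c d k (m + 1) = x ^ a * ((qpoch (c / x) q a * qpoch (x * d) q (Suc b) * qpoch q q (Suc (a + b))) /
       (qpoch q q a * qpoch q q (Suc b) * qpoch (c * d) q (Suc (a + b))))"
      unfolding ab m1 hop_nat by simp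
    have nz: "qpoch q q a \<noteq> 0" "qpoch q q b \<noteq> 0" "qpoch (c * d) q (a + b) \<noteq> 0"
        "1 - q * q ^ b \<noteq> 0" "1 - c * d * q ^ (a + b) \<noteq> 0"
      using q_pow_ne_1[of b] cd[of "a + b"] qpoch_nonzero[OF cd] qpoch_q_nonzero by auto
    have cancel: "X * ((C * (A * u) * (D * v)) / (E * (F * s) * (H * t))) * s * t =
        X * ((C * A * D) / (E * F * H)) * u * v"
      if "s \<noteq> 0" "t \<noteq> 0" "E \<noteq> 0" "F \<noteq> 0" "H \<noteq> 0" for X C A u D v E F s H t :: complex
      using that by (simp add: field_simps)
    show ?thesis
      unfolding p h1 unfolding ab hop_nat qpoch_Suc
      by (rule cancel) (use nz in auto)
  qed (auto simp: hop_outside)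
qed

lemma hop_step_move:
  assumes cd: "\<And>i. c * d * q ^ i \<noteq> 1" and "m \<ge> 0" and x: "x \<noteq> 0"
  shows "hop q x c d (k + 1) (m + 1) * (1 - q powi (k + 1)) * (1 - c * d * q powi m) =
    hop q x c d k m * (x - c * q powi k) * (1 - q powi (m + 1))"
proof -
  consider "k < -1" | "k = -1" | "k > m" | "0 \<le> k" "k \<le> m" by linarith
  then show ?thesis
  proof cases
    case 4
    define a b where "a = nat k" and "b = nat (m - k)"
    have ab: "k = int a" "m = int a + int b" using 4 by (auto simp: a_def b_def)
    have m1: "int a + int b + 1 = int (Suc a) + int b" and k1: "int a + 1 = int (Suc a)" by simp_all
    have e: "k + 1 = int (Suc a)" "m = int (a + b)" "k = int a" "m + 1 = int (Suc (a + b))"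
      using ab by auto
    have p: "q powi (k + 1) = q * q ^ a" "q powi m = q ^ (a + b)" "q powi k = q ^ a"
      "q powi (m + 1) = q * q ^ (a + b)"
      by (subst e; simp only: power_int_of_nat power_Suc)+
    have h1: "hop q x c d (k + 1) (m + 1) = x ^ Suc a * ((qpoch (c / x) q (Suc a) * qpoch (x * d) q b * qpoch q q (Suc (a + b))) /
       (qpoch q q (Suc a) * qpoch q q b * qpoch (c * d) q (Suc (a + b))))"
      unfolding ab m1 unfolding k1 hop_nat by simp
    have nz: "qpoch q q a \<noteq> 0" "qpoch q q b \<noteq> 0" "qpoch (c * d) q (a + b) \<noteq> 0"
        "1 - q * q ^ a \<noteq> 0" "1 - c * d * q ^ (a + b) \<noteq> 0"
      using q_pow_ne_1[of a] cd[of "a + b"] qpoch_nonzero[OF cd] qpoch_q_nonzero by auto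
    have cancel: "(x * X) * (((A * (1 - c / x * g)) * C * (D * v)) / ((E * s) * F * (H * t))) * s * t =
        X * ((A * C * D) / (E * F * H)) * (x - c * g) * v"
      if "s \<noteq> 0" "t \<noteq> 0" "E \<noteq> 0" "F \<noteq> 0" "H \<noteq> 0" for X C A g D v E F s H t :: complex
      using that x by (simp add: field_simps)
    show ?thesis
      unfolding p h1 unfolding ab hop_nat qpoch_Suc power_Suc
      by (rule cancel) (use nz in auto)
  qed (auto simp: hop_outside)
qed

text \<open>
  The four weights that occur in the matrix with entries \<open>N e f\<close> of lemma \<open>intertwine\<close> are expressed through
  \<open>hop k m\<close> and \<open>hop (k + 1) m\<close>, the two weights that occur in the matrix with entries \<open>M e f\<close>; the
  ratio relation connects these two.
\<close>

lemma hop_relations: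
  fixes k m :: int
  assumes cd: "\<And>i. c * d * q ^ i \<noteq> 1" and m: "m \<ge> 0" and x: "x \<noteq> 0"
  defines "K \<equiv> q powi k" and "J \<equiv> q powi (m - k)"
  shows hop_contiguous_down: "(1 - q powi m) * hop q x c d k (m - 1) =
      (1 - J) * hop q x c d k m + d * J / q * (1 - q * K) * hop q x c d (k + 1) m"
    and hop_ratio: "(1 - q * K) * (1 - x * d * J / q) * hop q x c d (k + 1) m =
      (x - c * K) * (1 - J) * hop q x c d k m"
    and hop_contiguous_up: "(1 - c * d * q powi m) * hop q x c d (k + 1) (m + 1) =
      (x - c * K) * hop q x c d k m + (q * K - x * d * q powi m) * hop q x c d (k + 1) m"
proof -
  have KJ: "q powi m = K * J" using q0 by (simp add: K_def J_def flip: power_int_add)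
  have K1: "q powi (k + 1) = q * K" using q0 by (simp add: K_def power_int_add)
  have ne: "c * d * q powi i \<noteq> 1" "q * q powi i \<noteq> 1" if "i \<ge> 0" for i
    using that cd[of "nat i"] q_pow_ne_1[of "nat i"] by (auto simp: power_int_def)
  have m1: "q powi (m + 1) = q * K * J" using q0 KJ by (simp add: power_int_add)
  show "(1 - c * d * q powi m) * hop q x c d (k + 1) (m + 1) =
      (x - c * K) * hop q x c d k m + (q * K - x * d * q powi m) * hop q x c d (k + 1) m"
  proof -
    have A: "hop q x c d (k + 1) (m + 1) * (1 - q * K) * (1 - c * d * (K * J)) =
        hop q x c d k m * (x - c * K) * (1 - q * K * J)"
      using hop_step_move[OF cd m x, of k] by (simp only: K1 KJ m1 K_def[symmetric])
    have j: "m + 1 - (k + 1) = m - k" by simp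
    have J1: "q powi (m - (k + 1)) = J / q"
      using q0 by (simp add: J_def power_int_diff power_int_add)
    have B: "hop q x c d (k + 1) (m + 1) * (1 - J) * (1 - c * d * (K * J)) =
        hop q x c d (k + 1) m * (1 - x * d * (J / q)) * (1 - q * K * J)"
      using hop_step_stay[OF cd m, of x "k + 1"] unfolding j J1 KJ m1 J_def[symmetric] .
    have nz: "1 - q * K * J \<noteq> 0" using ne(2)[OF m] KJ by (simp add: mult.assoc)
    \<comment> \<open>The last particle hops or stays: \<open>1 - q^(m+1) = (1 - q^(k+1)) + q^(k+1) (1 - q^(m-k))\<close>.\<close>
    have "(1 - q * K * J) * ((1 - c * d * (K * J)) * hop q x c d (k + 1) (m + 1)) =
        hop q x c d (k + 1) (m + 1) * (1 - q * K) * (1 - c * d * (K * J)) +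
        q * K * (hop q x c d (k + 1) (m + 1) * (1 - J) * (1 - c * d * (K * J)))"
      by (simp add: algebra_simps)
    also have "\<dots> = (1 - q * K * J) * ((x - c * K) * hop q x c d k m +
        (q * K - x * d * (K * J)) * hop q x c d (k + 1) m)"
      unfolding A B using q0 by (simp add: field_simps)
    finally show ?thesis using nz KJ by simp
  qed
  consider "m = 0" | "m \<ge> 1" using m by linarith
  then have "(1 - q powi m) * hop q x c d k (m - 1) =
      (1 - J) * hop q x c d k m + d * J / q * (1 - q * K) * hop q x c d (k + 1) m \<and>
    (1 - q * K) * (1 - x * d * J / q) * hop q x c d (k + 1) m =
      (x - c * K) * (1 - J) * hop q x c d k m"
  proof cases
    case 1
    consider "k = 0" | "k = -1" | "k < -1" | "k > 0" by linarith
    then show ?thesis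
    proof cases
      case 1 then show ?thesis using \<open>m = 0\<close> by (simp add: hop_outside J_def)
    next
      case 2 then show ?thesis using \<open>m = 0\<close> q0 by (simp add: hop_outside K_def)
    qed (auto simp: hop_outside \<open>m = 0\<close>)
  next
    case 2
    then have m': "m - 1 \<ge> 0" by simp
    have pm: "q powi (m - 1) = K * J / q" and pj: "q powi (m - 1 - k) = J / q"
      using q0 KJ by (simp_all add: power_int_diff J_def)
    have S: "hop q x c d k m * (1 - J) * (1 - c * d * (K * J / q)) =
        hop q x c d k (m - 1) * (1 - x * d * (J / q)) * (1 - K * J)"
      using hop_step_stay[OF cd m', of x k] by (simp add: pm pj KJ flip: J_def)
    have M: "hop q x c d (k + 1) m * (1 - q * K) * (1 - c * d * (K * J / q)) =
        hop q x c d k (m - 1) * (x - c * K) * (1 - K * J)"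
      using hop_step_move[OF cd m' x, of k] by (simp add: pm K1 KJ flip: K_def)
    define t where "t = 1 - c * d * (K * J / q)"
    have t: "t \<noteq> 0" using ne(1)[OF m'] pm by (simp add: t_def)
    have "t * ((1 - K * J) * hop q x c d k (m - 1)) =
        t * ((1 - J) * hop q x c d k m + d * J / q * (1 - q * K) * hop q x c d (k + 1) m)"
    proof -
      have "t * ((1 - J) * hop q x c d k m + d * J / q * (1 - q * K) * hop q x c d (k + 1) m) =
          hop q x c d k m * (1 - J) * t + d * J / q * (hop q x c d (k + 1) m * (1 - q * K) * t)"
        by (simp only: distrib_left mult_ac)
      also have "\<dots> = hop q x c d k (m - 1) * (1 - x * d * (J / q)) * (1 - K * J) +
          d * J / q * (hop q x c d k (m - 1) * (x - c * K) * (1 - K * J))"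
        using S M unfolding t_def[symmetric] by (simp only:)
      also have "\<dots> = t * ((1 - K * J) * hop q x c d k (m - 1))"
        unfolding t_def using q0 by (simp add: field_simps)
      finally show ?thesis by (rule sym)
    qed
    moreover have "t * ((1 - q * K) * (1 - x * d * J / q) * hop q x c d (k + 1) m) =
        t * ((x - c * K) * (1 - J) * hop q x c d k m)"
    proof -
      have "t * ((1 - q * K) * (1 - x * d * J / q) * hop q x c d (k + 1) m) =
          (1 - x * d * J / q) * (hop q x c d (k + 1) m * (1 - q * K) * t)"
        by (simp only: mult_ac)
      also have "\<dots> = (x - c * K) * (hop q x c d k m * (1 - J) * t)"
        using S M unfolding t_def[symmetric] by simp
      finally show ?thesis by (simp add: algebra_simps)
    qed
    ultimately show ?thesis using t KJ by simp
  qed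
  then show "(1 - q powi m) * hop q x c d k (m - 1) =
      (1 - J) * hop q x c d k m + d * J / q * (1 - q * K) * hop q x c d (k + 1) m"
    and "(1 - q * K) * (1 - x * d * J / q) * hop q x c d (k + 1) m =
      (x - c * K) * (1 - J) * hop q x c d k m"
    by auto
qed


section \<open>The intertwining relation\<close>

text \<open>
  The Yang--Baxter equation behind everything else.  The hop \<open>k'\<close> and the parameter \<open>c'\<close> belong to the
  next row; both sides are affine in \<open>q^k'\<close>, and in each entry their difference is a multiple of \<open>R1 - R2\<close>,
  which vanishes by the ratio relation between the two hopping weights of this row.
\<close>

lemma intertwine:
  fixes k k' m :: int and c' z :: complex
  assumes cd: "\<And>i. c * d * q ^ i \<noteq> 1" and m: "m \<ge> 0" and x: "x \<noteq> 0"
  defines "M \<equiv> \<lambda>e f. hop q x c d (k + of_bool e) m *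
      pieri_wt z c' d e f (q powi (m - k + k' + of_bool f - of_bool e))"
    and "N \<equiv> \<lambda>e f. pieri_wt z c d e f (q powi m) * hop q x c d (k + of_bool e) (m + of_bool e - of_bool f)"
  shows "N e False * gauge q z x c' (q powi k') False g + N e True * gauge q z x c' (q powi k') True g =
    gauge q z x c (q powi k) e False * M False g + gauge q z x c (q powi k) e True * M True g"
proof -
  define K K' D where "K = q powi k" and "K' = q powi k'" and "D = d * q powi (m - k) / q"
  define J where "J = q powi (m - k)"
  define a b u v where "a = hop q x c d k m" and "b = hop q x c d (k + 1) m"
    and "u = (1 - q powi m) * hop q x c d k (m - 1)" and "v = (1 - c * d * q powi m) * hop q x c d (k + 1) (m + 1)"
  have dJ: "d * J = q * D" using q0 by (simp add: D_def J_def)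
  have KJ: "q powi m = K * J" using q0 by (simp add: K_def J_def flip: power_int_add)
  have dm: "d * q powi m = q * D * K" by (simp add: KJ mult.left_commute dJ) 
  have xd: "x * (q * D * K) = x * d * q powi m" by (simp add: dm mult.assoc)
  have dzm: "z * (q * D * K) = d * z * q powi m" by (simp add: dm mult.left_commute)
  have p: "q powi (m - k + k') = J * K'" "q powi (m - k + k' + 1) = q * J * K'"
    "q powi (m - k + k' - 1) = J * K' / q"
    using q0 by (simp_all add: power_int_add power_int_diff J_def K'_def)
  have u: "u = (1 - J) * a + D * (1 - q * K) * b"
    using hop_contiguous_down[OF cd m x, of k] by (simp add: u_def a_def b_def J_def D_def K_def)
  have v: "v = (x - c * K) * a + (q * K - x * (q * D * K)) * b"
    using hop_contiguous_up[OF cd m x, of k] unfolding xd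
    by (simp add: v_def a_def b_def K_def)
  define R1 R2 where "R1 = (1 - q * K) * (1 - x * D) * b" and "R2 = (x - c * K) * (1 - J) * a"
  have R: "R1 = R2"
    using hop_ratio[OF cd m x, of k] by (simp add: R1_def R2_def a_def b_def J_def D_def K_def mult.assoc)
  have N: "N False False = (z - c * (K * J)) * a" "N False True = z * u"
    "N True False = - v" "N True True = - (1 - z * (q * D * K)) * b"
    unfolding dzm minus_mult_left
    by (simp_all only: N_def pieri_wt_def a_def b_def u_def v_def KJ[symmetric])
       (simp_all add: left_diff_distrib)
  have c'd: "c' * d * (J * K' / q) = c' * D * K'" "d * z * (J * K') = z * q * D * K'"
    using dJ q0 by (simp_all add: field_simps)
  have M: "M False False = a * (z - c' * (J * K'))" "M False True = a * (z * (1 - q * J * K'))"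
    "M True False = - b * (1 - c' * D * K')" "M True True = - b * (1 - z * q * D * K')"
    by (simp_all add: M_def pieri_wt_def p a_def b_def c'd left_diff_distrib right_diff_distrib flip: c'd)
  show ?thesis
  proof (cases e; cases g)
    assume "\<not> e" "\<not> g"
    have "(z - c * (K * J)) * a * (z - c' * K') + z * u * - (x - c' * K') -
        ((z - c * K) * (a * (z - c' * (J * K'))) + z * (1 - q * K) * (- b * (1 - c' * D * K'))) =
        z * (R1 - R2)"
      unfolding u R1_def R2_def by (simp add: algebra_simps)
    then show ?thesis using R \<open>\<not> e\<close> \<open>\<not> g\<close> by (simp add: N M gauge_def K_def[symmetric] K'_def[symmetric])
  next
    assume "\<not> e" "g"
    have "(z - c * (K * J)) * a * (z * (1 - q * K')) + z * u * (z * (q * K') - x) -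
        ((z - c * K) * (a * (z * (1 - q * J * K'))) + z * (1 - q * K) * (- b * (1 - z * q * D * K'))) =
        z * (R1 - R2)"
      unfolding u R1_def R2_def by (simp add: algebra_simps)
    then show ?thesis using R \<open>\<not> e\<close> \<open>g\<close> by (simp add: N M gauge_def K_def[symmetric] K'_def[symmetric])
  next
    assume "e" "\<not> g"
    have "- v * (z - c' * K') + - (1 - z * (q * D * K)) * b * - (x - c' * K') -
        (- (x - c * K) * (a * (z - c' * (J * K'))) + (z * (q * K) - x) * (- b * (1 - c' * D * K'))) =
        c' * K' * (R2 - R1)"
      unfolding v R1_def R2_def by (simp add: algebra_simps)
    then show ?thesis using R \<open>e\<close> \<open>\<not> g\<close> by (simp add: N M gauge_def K_def[symmetric] K'_def[symmetric])
  next
    assume "e" "g"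
    have "- v * (z * (1 - q * K')) + - (1 - z * (q * D * K)) * b * (z * (q * K') - x) -
        (- (x - c * K) * (a * (z * (1 - q * J * K'))) + (z * (q * K) - x) * (- b * (1 - z * q * D * K'))) =
        z * q * K' * (R2 - R1)"
      unfolding v R1_def R2_def by (simp add: algebra_simps)
    then show ?thesis using R \<open>e\<close> \<open>g\<close> by (simp add: N M gauge_def K_def[symmetric] K'_def[symmetric])
  qed
qed

text \<open>
  The local relation moves the gauge matrix through the chain.  In the last row all particles hop, as \<open>kap\<close>
  has one part less than \<open>lam\<close>; there the strip added after branching has ended, which leaves the scalar
  \<open>hop (m (r + l)) (m (r + l))\<close> and explains why the chain on the right is shorter by one.
\<close>

lemma tail_intertwine:
  assumes cd: "\<And>s i. r \<le> s \<Longrightarrow> s \<le> r + l \<Longrightarrow> c s * d s * q ^ i \<noteq> 1"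
    and m: "\<And>s. r \<le> s \<Longrightarrow> m s \<ge> 0" and x: "x \<noteq> 0" and last: "k (r + l) = m (r + l)"
  shows "tail (pieri_branch_mat q z x c d k m) r (Suc l) e =
    hop q x (c (r + l)) (d (r + l)) (m (r + l)) (m (r + l)) *
    (gauge q z x (c r) (q powi k r) e False * tail (branch_pieri_mat q z x c d k m) r l False +
     gauge q z x (c r) (q powi k r) e True * tail (branch_pieri_mat q z x c d k m) r l True)"
  using assms(1) m last
proof (induction l arbitrary: r e)
  case 0
  have cd: "c r * d r * q ^ i \<noteq> 1" for i using 0 by auto
  have m: "m r \<ge> 0" using 0 by auto
  have "- ((1 - c r * d r * q powi m r) * hop q x (c r) (d r) (m r + 1) (m r + 1)) =
      - ((x - c r * q powi m r) * hop q x (c r) (d r) (m r) (m r))"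
    using hop_contiguous_up[OF cd m x, of "m r"] by (simp add: hop_outside)
  then show ?case
    using 0 by (cases e) (simp_all add: pieri_branch_mat_def pieri_wt_def gauge_def algebra_simps)
next
  case (Suc l)
  have cd: "c r * d r * q ^ i \<noteq> 1" for i using Suc.prems by auto
  have m: "m r \<ge> 0" using Suc.prems by auto
  define H where "H = hop q x (c (r + Suc l)) (d (r + Suc l)) (m (r + Suc l)) (m (r + Suc l))"
  let ?N = "pieri_branch_mat q z x c d k m" and ?M = "branch_pieri_mat q z x c d k m"
  let ?G = "\<lambda>r. gauge q z x (c r) (q powi k r)"
  have IH: "tail ?N (Suc r) (Suc l) e = H * (?G (Suc r) e False * tail ?M (Suc r) l False +
     ?G (Suc r) e True * tail ?M (Suc r) l True)" for e
    using Suc.IH[of "Suc r" e] Suc.prems by (simp add: H_def)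
  have loc: "?N r e False * ?G (Suc r) False g + ?N r e True * ?G (Suc r) True g =
      ?G r e False * ?M r False g + ?G r e True * ?M r True g" for g
    using intertwine[OF cd m x, where k = "k r" and k' = "k (Suc r)" and c' = "c (Suc r)"]
    by (simp add: pieri_branch_mat_def branch_pieri_mat_def)
  have "tail ?N r (Suc (Suc l)) e = H * ((?N r e False * ?G (Suc r) False False + ?N r e True * ?G (Suc r) True False) * tail ?M (Suc r) l False
     + (?N r e False * ?G (Suc r) False True + ?N r e True * ?G (Suc r) True True) * tail ?M (Suc r) l True)"
    unfolding tail.simps(2)[of ?N r "Suc l"] IH by (simp add: algebra_simps)
  also have "\<dots> = H * (?G r e False * tail ?M r (Suc l) False + ?G r e True * tail ?M r (Suc l) True)"
    unfolding loc by (simp add: algebra_simps)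
  finally show ?case unfolding H_def .
qed


section \<open>Branching rule\<close>

lemma sqW_Suc_box:
  assumes "lam 0 = 0" "\<And>i. i > Suc n \<Longrightarrow> lam i = 0" "\<And>i. lam i \<le> L"
  shows "sqW q (Suc n) lam x c d =
    (\<Sum>mu\<in>box n L. skew_prod q (Suc n) lam mu (x (Suc n)) c d * sqW q n mu x (\<lambda>i. c (Suc i)) d)"
proof -
  have sub: "{mu. mu \<in> partitions n \<and> interlaces mu lam} \<subseteq> box n L"
  proof (clarsimp simp: partitions_def interlaces_def box_def)
    fix mu i assume h: "mu 0 = 0" "\<forall>i\<ge>Suc 0. mu i \<le> lam i \<and> lam (Suc i) \<le> mu i"
    show "mu i \<le> L"
    proof (cases "i = 0")
      case False
      then have "mu i \<le> lam i" using h(2) by auto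
      then show ?thesis using assms(3)[of i] by linarith
    qed (simp add: h(1))
  qed
  have "sqW q (Suc n) lam x c d = (\<Sum>mu | mu \<in> partitions n \<and> interlaces mu lam.
       skew_prod q (Suc n) lam mu (x (Suc n)) c d * sqW q n mu x (\<lambda>i. c (Suc i)) d)"
    unfolding sqW.simps using assms(1,2)
    by (intro sum.cong) (auto simp: sqW_skew_eq_skew_prod partitions_def)
  also have "\<dots> = (\<Sum>mu\<in>box n L. skew_prod q (Suc n) lam mu (x (Suc n)) c d * sqW q n mu x (\<lambda>i. c (Suc i)) d)"
  proof (rule sum.mono_neutral_left[OF finite_box sub], rule ballI)
    fix mu assume "mu \<in> box n L - {mu. mu \<in> partitions n \<and> interlaces mu lam}"
    then have "skew_prod q (Suc n) lam mu (x (Suc n)) c d = 0"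
      using skew_prod_nonzeroD[of q n lam mu] assms(2) by (fastforce simp: box_def)
    then show "skew_prod q (Suc n) lam mu (x (Suc n)) c d * sqW q n mu x (\<lambda>i. c (Suc i)) d = 0" by simp
  qed
  finally show ?thesis .
qed

text \<open>
  Changing the summation variable from \<open>mu\<close> to \<open>kap = mu + S\<close>.  The summand is a function of integer
  sequences since \<open>kap - S\<close> may have negative entries; the hypothesis says that such terms contribute nothing.
\<close>

lemma sum_add_strip:
  assumes van: "\<And>kap S r. r \<in> {1..n} \<Longrightarrow> kap r < 0 \<or> kap r > int L \<Longrightarrow> h kap S = 0"
  shows "(\<Sum>mu\<in>box n L. \<Sum>S\<in>Pow {1..n}. h (\<lambda>i. int (mu i)) S * G (add_strip mu S)) =
    (\<Sum>kap\<in>box n (Suc L). (\<Sum>S\<in>Pow {1..n}. h (\<lambda>i. int (kap i) - of_bool (i \<in> S)) S) * (G kap :: complex))"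
proof -
  have "(\<Sum>mu\<in>box n L. h (\<lambda>i. int (mu i)) S * G (add_strip mu S)) =
      (\<Sum>kap\<in>box n (Suc L). h (\<lambda>i. int (kap i) - of_bool (i \<in> S)) S * G kap)"
    if S: "S \<subseteq> {1..n}" for S
  proof -
    let ?f = "\<lambda>mu. add_strip mu S"
    have inj: "inj_on ?f (box n L)"
      by (rule inj_onI) (auto simp: add_strip_def fun_eq_iff)
    have sub: "?f ` box n L \<subseteq> box n (Suc L)"
      using S by (fastforce simp: box_def add_strip_def intro: le_SucI)
    have "(\<Sum>mu\<in>box n L. h (\<lambda>i. int (mu i)) S * G (add_strip mu S)) =
        (\<Sum>kap\<in>?f ` box n L. h (\<lambda>i. int (kap i) - of_bool (i \<in> S)) S * G kap)"
      by (simp add: sum.reindex[OF inj] add_strip_def)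
    also have "\<dots> = (\<Sum>kap\<in>box n (Suc L). h (\<lambda>i. int (kap i) - of_bool (i \<in> S)) S * G kap)"
    proof (rule sum.mono_neutral_left[OF finite_box sub], rule ballI)
      fix kap assume kap: "kap \<in> box n (Suc L) - ?f ` box n L"
      define kap' where "kap' i = int (kap i) - of_bool (i \<in> S)" for i
      have "\<exists>r\<in>{1..n}. kap' r < 0 \<or> kap' r > int L"
      proof (rule ccontr)
        assume "\<not> ?thesis"
        then have b: "0 \<le> kap' r" "kap' r \<le> int L" if "r \<in> {1..n}" for r
          using that by (meson not_le)+
        have o: "kap' r = 0" if "r \<notin> {1..n}" for r
        proof -
          have "r = 0 \<or> r > n" using that by auto
          moreover have "r \<notin> S" using that S by auto
          ultimately show ?thesis using kap by (auto simp: kap'_def box_def)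
        qed
        have b': "0 \<le> kap' r" "kap' r \<le> int L" for r
          using b[of r] o[of r] by (cases "r \<in> {1..n}"; simp)+
        have "(\<lambda>i. nat (kap' i)) \<in> box n L"
          using o b' by (auto simp: box_def nat_le_iff)
        moreover have "kap = ?f (\<lambda>i. nat (kap' i))"
        proof
          fix i show "kap i = add_strip (\<lambda>i. nat (kap' i)) S i"
            using b'(1)[of i] by (auto simp: add_strip_def kap'_def split: if_splits)
        qed
        ultimately show False using kap by auto
      qed
      then have "h kap' S = 0" using van by blast
      then show "h (\<lambda>i. int (kap i) - of_bool (i \<in> S)) S * G kap = 0"
        by (simp add: kap'_def[abs_def])
    qed
    finally show ?thesis .
  qed
  then have "(\<Sum>S\<in>Pow {1..n}. \<Sum>mu\<in>box n L. h (\<lambda>i. int (mu i)) S * G (add_strip mu S)) =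
      (\<Sum>S\<in>Pow {1..n}. \<Sum>kap\<in>box n (Suc L). h (\<lambda>i. int (kap i) - of_bool (i \<in> S)) S * G kap)"
    by - (rule sum.cong[OF refl], simp only: Pow_iff)
  then show ?thesis
    by (subst sum.swap, simp only: sum_distrib_right, subst (2) sum.swap)
qed

text \<open>
  Branching followed by a Pieri expansion, collected by the coefficient of \<open>G kap\<close>.  The Pieri rule
  uses it for \<open>U = 1\<close>; the eigenrelation uses a \<open>U\<close> that depends on the first part of \<open>mu\<close> and on
  whether the strip meets the first row.
\<close>

lemma branch_pieri_sum:
  fixes U :: "int \<Rightarrow> bool \<Rightarrow> complex" and G :: "(nat \<Rightarrow> nat) \<Rightarrow> complex"
  assumes lam: "\<And>i. i > Suc n \<Longrightarrow> lam i = 0" "\<And>i. lam i \<le> L"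
  defines "m \<equiv> \<lambda>r. int (lam r) - int (lam (Suc r))"
  shows "(\<Sum>mu\<in>box n L. skew_prod q (Suc n) lam mu x c d * (\<Sum>S\<in>Pow {1..n}.
        U (int (mu 1)) (1 \<in> S) * pieri_coef q z n mu (\<lambda>i. c (Suc i)) d S * G (add_strip mu S))) =
    (\<Sum>kap\<in>box n (Suc L). hop q x (c (Suc n)) (d (Suc n)) (m (Suc n)) (m (Suc n)) *
      (U (int (kap 1)) False * tail (branch_pieri_mat q z x c d (\<lambda>r. int (lam r) - int (kap r)) m) 1 n False +
       U (int (kap 1) - 1) True * tail (branch_pieri_mat q z x c d (\<lambda>r. int (lam r) - int (kap r)) m) 1 n True) * G kap)"
proof -
  define h where "h kap S = (\<Prod>r=1..Suc n. hop q x (c r) (d r) (int (lam r) - kap r) (m r)) *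
     (U (kap 1) (1 \<in> S) * (\<Prod>r=1..n. pieri_wt z (c (Suc r)) (d r) (r \<in> S) (Suc r \<in> S) (q powi (kap r - kap (Suc r)))))"
    for kap and S :: "nat set"
  have van: "h kap S = 0" if "r \<in> {1..n}" "kap r < 0 \<or> kap r > int L" for kap S r
  proof -
    have "hop q x (c r) (d r) (int (lam r) - kap r) (m r) = 0"
      using that lam(2)[of r] by (intro hop_outside) (auto simp: m_def)
    then have "(\<Prod>r=1..Suc n. hop q x (c r) (d r) (int (lam r) - kap r) (m r)) = 0"
      using that by (intro prod_zero) auto
    then show ?thesis by (simp add: h_def)
  qed
  have "(\<Sum>mu\<in>box n L. skew_prod q (Suc n) lam mu x c d * (\<Sum>S\<in>Pow {1..n}.
        U (int (mu 1)) (1 \<in> S) * pieri_coef q z n mu (\<lambda>i. c (Suc i)) d S * G (add_strip mu S))) =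
      (\<Sum>mu\<in>box n L. \<Sum>S\<in>Pow {1..n}. h (\<lambda>i. int (mu i)) S * G (add_strip mu S))"
    by (simp only: sum_distrib_left h_def skew_prod_def pieri_coef_def m_def mult.assoc)
  also have "\<dots> = (\<Sum>kap\<in>box n (Suc L). (\<Sum>S\<in>Pow {1..n}. h (\<lambda>i. int (kap i) - of_bool (i \<in> S)) S) * G kap)"
    using van by (rule sum_add_strip)
  also have "\<dots> = (\<Sum>kap\<in>box n (Suc L). hop q x (c (Suc n)) (d (Suc n)) (m (Suc n)) (m (Suc n)) *
      (U (int (kap 1)) False * tail (branch_pieri_mat q z x c d (\<lambda>r. int (lam r) - int (kap r)) m) 1 n False +
       U (int (kap 1) - 1) True * tail (branch_pieri_mat q z x c d (\<lambda>r. int (lam r) - int (kap r)) m) 1 n True) * G kap)"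
  proof (intro sum.cong refl arg_cong2[where f = "(*)"])
    fix kap assume kap: "kap \<in> box n (Suc L)"
    let ?M = "branch_pieri_mat q z x c d (\<lambda>r. int (lam r) - int (kap r)) m"
    let ?H = "hop q x (c (Suc n)) (d (Suc n)) (m (Suc n)) (m (Suc n))"
    have "h (\<lambda>i. int (kap i) - of_bool (i \<in> S)) S =
        ?H * (U (int (kap 1) - of_bool (1 \<in> S)) (1 \<in> S) * (\<Prod>i\<in>{1..<1 + n}. ?M i (i \<in> S) (Suc i \<in> S)))"
      if S: "S \<in> Pow {1..n}" for S
    proof -
      have last: "hop q x (c (Suc n)) (d (Suc n)) (int (lam (Suc n)) - (int (kap (Suc n)) - of_bool (Suc n \<in> S))) (m (Suc n)) = ?H"
        using S kap lam(1)[of "Suc (Suc n)"] by (auto simp: box_def m_def)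
      have a: "int (lam r) - (int (kap r) - of_bool (r \<in> S)) = int (lam r) - int (kap r) + of_bool (r \<in> S)"
        "int (kap r) - of_bool (r \<in> S) - (int (kap (Suc r)) - of_bool (Suc r \<in> S)) =
         m r - (int (lam r) - int (kap r)) + (int (lam (Suc r)) - int (kap (Suc r))) + of_bool (Suc r \<in> S) - of_bool (r \<in> S)"
        for r by (simp_all add: m_def)
      have "(\<Prod>r=1..Suc n. hop q x (c r) (d r) (int (lam r) - (int (kap r) - of_bool (r \<in> S))) (m r)) =
          (\<Prod>r=1..n. hop q x (c r) (d r) (int (lam r) - (int (kap r) - of_bool (r \<in> S))) (m r)) * ?H"
        using last by simp
      then have "h (\<lambda>i. int (kap i) - of_bool (i \<in> S)) S = ?H * (U (int (kap 1) - of_bool (1 \<in> S)) (1 \<in> S) *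
          ((\<Prod>r=1..n. hop q x (c r) (d r) (int (lam r) - (int (kap r) - of_bool (r \<in> S))) (m r)) *
           (\<Prod>r=1..n. pieri_wt z (c (Suc r)) (d r) (r \<in> S) (Suc r \<in> S)
             (q powi (int (kap r) - of_bool (r \<in> S) - (int (kap (Suc r)) - of_bool (Suc r \<in> S)))))))"
        unfolding h_def by (simp only: mult_ac)
      also have "((\<Prod>r=1..n. hop q x (c r) (d r) (int (lam r) - (int (kap r) - of_bool (r \<in> S))) (m r)) *
           (\<Prod>r=1..n. pieri_wt z (c (Suc r)) (d r) (r \<in> S) (Suc r \<in> S)
             (q powi (int (kap r) - of_bool (r \<in> S) - (int (kap (Suc r)) - of_bool (Suc r \<in> S)))))) =
          (\<Prod>i\<in>{1..<1 + n}. ?M i (i \<in> S) (Suc i \<in> S))"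
        unfolding prod.distrib[symmetric] a branch_pieri_mat_def
        by (intro prod.cong) auto
      finally show ?thesis .
    qed
    moreover have ivl: "{1..n} = {1..<1 + n}" by auto
    ultimately have "(\<Sum>S\<in>Pow {1..n}. h (\<lambda>i. int (kap i) - of_bool (i \<in> S)) S) =
        (\<Sum>S\<in>Pow {1..n}. ?H * (U (int (kap 1) - of_bool (1 \<in> S)) (1 \<in> S) * (\<Prod>i\<in>{1..<1 + n}. ?M i (i \<in> S) (Suc i \<in> S))))"
      by (intro sum.cong) auto
    also have "(\<Sum>S\<in>Pow {1..n}. ?H * (U (int (kap 1) - of_bool (1 \<in> S)) (1 \<in> S) * (\<Prod>i\<in>{1..<1 + n}. ?M i (i \<in> S) (Suc i \<in> S)))) =
        ?H * (U (int (kap 1)) False * tail ?M 1 n False + U (int (kap 1) - 1) True * tail ?M 1 n True)"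
      unfolding sum_distrib_left[symmetric] ivl
      using sum_subsets_eq_tail[of "\<lambda>e. U (int (kap 1) - of_bool e) e" 1 ?M n] by simp
    finally show "(\<Sum>S\<in>Pow {1..n}. h (\<lambda>i. int (kap i) - of_bool (i \<in> S)) S) =
        ?H * (U (int (kap 1)) False * tail ?M 1 n False + U (int (kap 1) - 1) True * tail ?M 1 n True)" .
  qed
  finally show ?thesis .
qed


section \<open>Pieri rule\<close>

text \<open>
  Induction on the number of variables.  For each \<open>kap\<close>, the coefficients of the polynomial indexed by
  \<open>kap\<close> in fewer variables are compared: on the left branching comes first, on the right the strip.
  The two chains differ by the gauge matrix of the first row, and summing over the bit of the first row
  produces its column sums, that is, the missing factor \<open>z - x (n + 1)\<close>.
\<close>

lemma pieri:
  assumes "nonresonant q n c d" and "lam \<in> partitions n" and "\<And>i. i \<in> {1..n} \<Longrightarrow> x i \<noteq> 0"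
  shows "(\<Prod>j=1..n. z - x j) * sqW q n lam x c d =
    (\<Sum>S\<in>Pow {1..n}. pieri_coef q z n lam c d S * sqW q n (add_strip lam S) x c d)"
  using assms
proof (induction n arbitrary: lam c)
  case 0
  then show ?case by (simp add: pieri_coef_def)
next
  case (Suc n)
  define y where "y = x (Suc n)"
  define c' where "c' = (\<lambda>i. c (Suc i))"
  define L where "L = lam 1"
  define m where "m r = int (lam r) - int (lam (Suc r))" for r
  define f where "f kap = sqW q n kap x c' d" for kap
  let ?M = "\<lambda>kap. branch_pieri_mat q z y c d (\<lambda>r. int (lam r) - int (kap r)) m"
  let ?N = "\<lambda>kap. pieri_branch_mat q z y c d (\<lambda>r. int (lam r) - int (kap r)) m"
  let ?H = "hop q y (c (Suc n)) (d (Suc n)) (m (Suc n)) (m (Suc n))"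
  have y: "y \<noteq> 0" using Suc.prems(3) by (simp add: y_def)
  have lam: "lam 0 = 0" "\<And>i. i > Suc n \<Longrightarrow> lam i = 0" "\<And>i. lam i \<le> L"
    using Suc.prems(2) partitions_le_first by (auto simp: partitions_def L_def)
  have m: "m r \<ge> 0" if "1 \<le> r" for r
    using Suc.prems(2) that by (auto simp: m_def partitions_def)
  have cd: "c s * d s * q ^ i \<noteq> 1" if "1 \<le> s" "s \<le> 1 + n" for s i
    using Suc.prems(1) that by (auto simp: nonresonant_def)
  have IH: "(\<Prod>j=1..n. z - x j) * f mu = (\<Sum>S\<in>Pow {1..n}. pieri_coef q z n mu c' d S * f (add_strip mu S))"
    if "mu \<in> partitions n" for mu
    unfolding f_def using Suc.IH[OF _ that, of c'] nonresonant_shift[OF Suc.prems(1)] Suc.prems(3)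
    by (simp add: c'_def)
  have sqW_f: "sqW q (Suc n) lam x c d = (\<Sum>mu\<in>box n L. skew_prod q (Suc n) lam mu y c d * f mu)"
    unfolding f_def c'_def y_def using lam by (rule sqW_Suc_box)
  have prod_Suc: "(\<Prod>j=1..Suc n. z - x j) = (z - y) * (\<Prod>j=1..n. z - x j)"
    by (simp add: y_def)
  have "(\<Prod>j=1..Suc n. z - x j) * sqW q (Suc n) lam x c d =
      (z - y) * (\<Sum>mu\<in>box n L. skew_prod q (Suc n) lam mu y c d * ((\<Prod>j=1..n. z - x j) * f mu))"
    unfolding sqW_f prod_Suc by (simp only: sum_distrib_left mult_ac)
  also have "(\<Sum>mu\<in>box n L. skew_prod q (Suc n) lam mu y c d * ((\<Prod>j=1..n. z - x j) * f mu)) =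
      (\<Sum>mu\<in>box n L. skew_prod q (Suc n) lam mu y c d *
        (\<Sum>S\<in>Pow {1..n}. (\<lambda>_ _. 1) (int (mu 1)) (1 \<in> S) * pieri_coef q z n mu (\<lambda>i. c (Suc i)) d S * f (add_strip mu S)))"
  proof (rule sum.cong[OF refl])
    fix mu assume mu: "mu \<in> box n L"
    show "skew_prod q (Suc n) lam mu y c d * ((\<Prod>j=1..n. z - x j) * f mu) = skew_prod q (Suc n) lam mu y c d *
        (\<Sum>S\<in>Pow {1..n}. (\<lambda>_ _. 1) (int (mu 1)) (1 \<in> S) * pieri_coef q z n mu (\<lambda>i. c (Suc i)) d S * f (add_strip mu S))"
    proof (cases "skew_prod q (Suc n) lam mu y c d = 0")
      case False
      then have "mu \<in> partitions n"
        by (rule skew_prod_nonzeroD) (use lam mu in \<open>auto simp: box_def\<close>)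
      then show ?thesis unfolding IH[OF \<open>mu \<in> partitions n\<close>] c'_def by simp
    qed simp
  qed
  also have "\<dots> = (\<Sum>kap\<in>box n (Suc L). ?H * (1 * tail (?M kap) 1 n False + 1 * tail (?M kap) 1 n True) * f kap)"
    unfolding m_def by (rule branch_pieri_sum[where U = "\<lambda>_ _. 1", OF lam(2,3)])
  also have "(z - y) * \<dots> = (\<Sum>kap\<in>box n (Suc L). (tail (?N kap) 1 (Suc n) False + tail (?N kap) 1 (Suc n) True) * f kap)"
    unfolding sum_distrib_left
  proof (rule sum.cong[OF refl])
    fix kap assume kap: "kap \<in> box n (Suc L)"
    have k: "int (lam (1 + n)) - int (kap (1 + n)) = m (1 + n)"
      using kap lam(2)[of "Suc (Suc n)"] by (simp add: box_def m_def)
    have T: "tail (?N kap) 1 (Suc n) e = ?H * (gauge q z y (c 1) (q powi (int (lam 1) - int (kap 1))) e False * tail (?M kap) 1 n False +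
        gauge q z y (c 1) (q powi (int (lam 1) - int (kap 1))) e True * tail (?M kap) 1 n True)" for e
      using tail_intertwine[where r = 1 and l = n and c = c and d = d and m = m and k = "\<lambda>r. int (lam r) - int (kap r)" and e = e and z = z, OF cd m y k]
      by (simp only: plus_1_eq_Suc)
    show "(z - y) * (?H * (1 * tail (?M kap) 1 n False + 1 * tail (?M kap) 1 n True) * f kap) =
        (tail (?N kap) 1 (Suc n) False + tail (?N kap) 1 (Suc n) True) * f kap"
      unfolding T
      by (simp add: gauge_def algebra_simps)
  qed
  also have "\<dots> = (\<Sum>kap\<in>box n (Suc L). (\<Sum>S\<in>Pow {1..Suc n}.
      pieri_coef q z (Suc n) lam c d S * skew_prod q (Suc n) (add_strip lam S) kap y c d) * f kap)"
  proof (rule sum.cong[OF refl])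
    fix kap
    have ivl: "{1..Suc n} = {1..<1 + Suc n}" by auto
    have "tail (?N kap) 1 (Suc n) False + tail (?N kap) 1 (Suc n) True =
        (\<Sum>S\<in>Pow {1..Suc n}. \<Prod>r=1..Suc n. ?N kap r (r \<in> S) (Suc r \<in> S))"
      unfolding ivl using sum_subsets_eq_tail[of "\<lambda>_. 1" 1 "?N kap" "Suc n"] by (simp only: mult_1_left)
    also have "\<dots> = (\<Sum>S\<in>Pow {1..Suc n}.
      pieri_coef q z (Suc n) lam c d S * skew_prod q (Suc n) (add_strip lam S) kap y c d)"
      unfolding pieri_coef_def skew_prod_def prod.distrib[symmetric] pieri_branch_mat_def add_strip_def m_def
      by (intro sum.cong prod.cong refl arg_cong2[where f = "(*)"] arg_cong2[where f = "hop q y (c _) (d _)"]) auto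
    finally show "(tail (?N kap) 1 (Suc n) False + tail (?N kap) 1 (Suc n) True) * f kap =
      (\<Sum>S\<in>Pow {1..Suc n}. pieri_coef q z (Suc n) lam c d S * skew_prod q (Suc n) (add_strip lam S) kap y c d) * f kap"
      by simp
  qed
  also have "\<dots> = (\<Sum>S\<in>Pow {1..Suc n}. pieri_coef q z (Suc n) lam c d S *
      (\<Sum>kap\<in>box n (Suc L). skew_prod q (Suc n) (add_strip lam S) kap y c d * f kap))"
    by (simp only: sum_distrib_right sum_distrib_left mult.assoc sum.swap[of _ "box n (Suc L)"])
  also have "\<dots> = (\<Sum>S\<in>Pow {1..Suc n}. pieri_coef q z (Suc n) lam c d S * sqW q (Suc n) (add_strip lam S) x c d)"
  proof (rule sum.cong[OF refl])
    fix S assume S: "S \<in> Pow {1..Suc n}"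
    have "sqW q (Suc n) (add_strip lam S) x c d =
        (\<Sum>kap\<in>box n (Suc L). skew_prod q (Suc n) (add_strip lam S) kap y c d * f kap)"
      unfolding f_def c'_def y_def
      by (rule sqW_Suc_box) (use S lam in \<open>auto simp: add_strip_def of_bool_def intro: le_SucI\<close>)
    then show "pieri_coef q z (Suc n) lam c d S * (\<Sum>kap\<in>box n (Suc L). skew_prod q (Suc n) (add_strip lam S) kap y c d * f kap) =
        pieri_coef q z (Suc n) lam c d S * sqW q (Suc n) (add_strip lam S) x c d"
      by simp
  qed
  finally show ?case .
qed


section \<open>The eigenrelation\<close>

text \<open>
  At \<open>x = z\<close> the tails of the chain are multiples of the vector \<open>(1, -1)\<close>.  This is
  the first entry of the image of \<open>(1, -1)\<close> under one matrix of the chain, where the hopping weight at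
  \<open>z / q\<close> appears.
\<close>

lemma hop_shift:
  assumes cd: "\<And>i. c * d * q ^ i \<noteq> 1" and m: "m \<ge> 0" and z: "z \<noteq> 0"
  shows "(z - c * q powi m) * hop q z c d k m - z * (1 - q powi m) * hop q z c d k (m - 1) =
    q powi m * (z - c) * hop q (z / q) c d k m"
proof -
  have c_shift: "(z - c) * qpoch (c / (z / q)) q a = (z - c * q ^ a) * qpoch (c / z) q a" for a
  proof -
    have "(1 - c / z) * qpoch (c / (z / q)) q a = qpoch (c / z) q (Suc a)"
      unfolding qpoch_Suc_left by (simp add: mult.commute)
    also have "\<dots> = (1 - c / z * q ^ a) * qpoch (c / z) q a"
      by (simp add: qpoch_Suc)
    finally have "z * ((1 - c / z) * qpoch (c / (z / q)) q a) = z * ((1 - c / z * q ^ a) * qpoch (c / z) q a)"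
      by simp
    then show ?thesis using z by (simp add: algebra_simps)
  qed
  have pow: "q ^ a * (z / q) ^ a = z ^ a" for a
    using q0 by (simp add: power_divide)
  consider "k < 0 \<or> k > m" | "0 \<le> k" "k = m" | "0 \<le> k" "k < m" by linarith
  then show ?thesis
  proof cases
    case 1
    then show ?thesis by (auto simp: hop_outside)
  next
    case 2
    define a where "a = nat k"
    have a: "m = int a + int 0" "k = int a" using 2 by (simp_all add: a_def)
    have am: "q powi (int a + int 0) = q ^ a" by simp
    have "(z - c * q ^ a) * hop q z c d (int a) (int a + int 0) =
        q ^ a * (z - c) * hop q (z / q) c d (int a) (int a + int 0)"
    proof -
      have "q ^ a * (z - c) * hop q (z / q) c d (int a) (int a + int 0) =
          (q ^ a * (z / q) ^ a) * (((z - c) * qpoch (c / (z / q)) q a) * qpoch q q a / (qpoch q q a * qpoch (c * d) q a))"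
        unfolding hop_nat by simp
      also have "\<dots> = (z - c * q ^ a) * hop q z c d (int a) (int a + int 0)"
        unfolding pow c_shift hop_nat by simp
      finally show ?thesis by simp
    qed
    moreover have "hop q z c d (int a) (int a + int 0 - 1) = 0" by (simp add: hop_outside)
    ultimately show ?thesis unfolding a am by simp
  next
    case 3
    define a b where "a = nat k" and "b = nat (m - k - 1)"
    have ab: "k = int a" "m = int a + int (Suc b)" using 3 by (simp_all add: a_def b_def)
    have mm: "m - 1 = int a + int b" using ab by simp
    have m'0: "m - 1 \<ge> 0" using mm by simp
    define h where "h = hop q z c d k (m - 1)"
    define t where "t = (1 - q * q ^ b) * (1 - c * d * q ^ (a + b))"
    have t: "t \<noteq> 0" using q_pow_ne_1[of b] cd[of "a + b"] by (auto simp: t_def)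
    have pm: "q powi m = q * q ^ a * q ^ b"
      unfolding ab by (simp add: power_int_add power_add q0 flip: of_nat_Suc)
    have p: "q powi (m - k) = q * q ^ b" "q powi (m - 1) = q ^ (a + b)" "q powi (m - 1 - k) = q ^ b"
    proof -
      have "m - k = int (Suc b)" "m - 1 = int (a + b)" "m - 1 - k = int b" using ab by simp_all
      then show "q powi (m - k) = q * q ^ b" "q powi (m - 1) = q ^ (a + b)" "q powi (m - 1 - k) = q ^ b"
        by (simp_all only: power_int_of_nat power_Suc)
    qed
    have S: "hop q z c d k m * t = h * (1 - z * d * q ^ b) * (1 - q powi m)"
      using hop_step_stay[OF cd m'0, of z k] by (simp add: p h_def t_def mult.assoc)
    have T: "q powi m * (z - c) * hop q (z / q) c d k m * t =
        q * q ^ b * (z - c * q ^ a) * (1 - z * d / q) * (1 - q powi m) * h"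
    proof -
      have nz: "qpoch q q a \<noteq> 0" "qpoch q q b \<noteq> 0" "qpoch (c * d) q (a + b) \<noteq> 0"
        "1 - q * q ^ b \<noteq> 0" "1 - c * d * q ^ (a + b) \<noteq> 0"
        using q_pow_ne_1[of b] cd[of "a + b"] qpoch_nonzero[OF cd] qpoch_q_nonzero by auto
      have e: "a + Suc b = Suc (a + b)" by simp
      have xd: "qpoch (z / q * d) q (Suc b) = (1 - z * d / q) * qpoch (z * d) q b"
        unfolding qpoch_Suc_left using q0 by simp
      have cancel: "X * ((A * (u * B) * (D * v)) / (E * (F * s) * (H * t'))) * (s * t') = X * A * u * v * (B * D / (E * F * H))"
        if "s \<noteq> 0" "t' \<noteq> 0" "E \<noteq> 0" "F \<noteq> 0" "H \<noteq> 0" for X A u B D v E F s H t' :: complex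
        using that by (simp add: field_simps)
      have H: "hop q (z / q) c d k m * t = (z / q) ^ a * qpoch (c / (z / q)) q a * (1 - z * d / q) * (1 - q powi m) *
          (qpoch (z * d) q b * qpoch q q (a + b) / (qpoch q q a * qpoch q q b * qpoch (c * d) q (a + b)))"
        unfolding ab hop_nat e t_def xd qpoch_Suc[of q] qpoch_Suc[of "c * d"]
        unfolding cancel[OF nz(4,5,1-3)]
        using pm unfolding ab by (simp add: power_add mult.assoc)
      have "q powi m * (z - c) * (hop q (z / q) c d k m * t) =
          q * q ^ b * ((q ^ a * (z / q) ^ a) * ((z - c) * qpoch (c / (z / q)) q a)) * (1 - z * d / q) * (1 - q powi m) *
          (qpoch (z * d) q b * qpoch q q (a + b) / (qpoch q q a * qpoch q q b * qpoch (c * d) q (a + b)))"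
        unfolding H pm by (simp only: mult_ac)
      also have "\<dots> = q * q ^ b * (z - c * q ^ a) * (1 - z * d / q) * (1 - q powi m) * h"
        unfolding pow c_shift h_def mm ab(1) hop_nat by simp
      finally show ?thesis by (simp only: mult.assoc)
    qed
    have "((z - c * q powi m) * hop q z c d k m - z * (1 - q powi m) * h) * t =
        (z - c * q powi m) * (hop q z c d k m * t) - z * (1 - q powi m) * h * t"
      by (simp add: algebra_simps)
    also have "\<dots> = ((z - c * q powi m) * (1 - z * d * q ^ b) - z * t) * ((1 - q powi m) * h)"
      unfolding S by (simp add: algebra_simps)
    also have "(z - c * q powi m) * (1 - z * d * q ^ b) - z * t = q * q ^ b * (z - c * q ^ a) * (1 - z * d / q)"
      unfolding t_def pm using q0 by (simp add: field_simps power_add)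
    finally have "((z - c * q powi m) * hop q z c d k m - z * (1 - q powi m) * h) * t =
        (q powi m * (z - c) * hop q (z / q) c d k m) * t"
      unfolding T by (simp only: mult_ac)
    then show ?thesis using t by (simp add: h_def)
  qed
qed

text \<open>
  Since the column sums of the gauge matrix vanish at \<open>x = z\<close>, the two entries of each tail are opposite,
  and each row contributes the scalar of lemma \<open>hop_shift\<close>.  In the last row \<open>c\<close> vanishes, which turns
  the factor \<open>z - c\<close> into \<open>z\<close>.
\<close>

lemma tail_degenerate:
  assumes cd: "\<And>s i. r \<le> s \<Longrightarrow> s \<le> r + l \<Longrightarrow> c s * d s * q ^ i \<noteq> 1"
    and m: "\<And>s. r \<le> s \<Longrightarrow> m s \<ge> 0" and z: "z \<noteq> 0"
    and last: "k (r + l) = m (r + l)"  "c (r + l) = 0"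
  shows "tail (pieri_branch_mat q z z c d k m) r (Suc l) False =
    z * (\<Prod>i\<in>{r..<r + l}. z - c i) * (\<Prod>i\<in>{r..<Suc (r + l)}. q powi m i * hop q (z / q) (c i) (d i) (k i) (m i))"
  using cd m last
proof (induction l arbitrary: r)
  case 0
  have cd: "c r * d r * q ^ i \<noteq> 1" for i using 0 by auto
  show ?case
    using hop_shift[OF cd _ z, of "m r" "k r"] 0
    by (simp add: pieri_branch_mat_def pieri_wt_def hop_outside)
next
  case (Suc l)
  let ?N = "pieri_branch_mat q z z c d k m"
  have cd: "c r * d r * q ^ i \<noteq> 1" for i using Suc.prems by auto
  have "tail ?N (Suc r) (Suc l) True = - tail ?N (Suc r) (Suc l) False"
    by (subst (1 2) tail_intertwine) (use Suc.prems z in \<open>auto simp: gauge_def algebra_simps\<close>)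
  then have "tail ?N r (Suc (Suc l)) False = (?N r False False - ?N r False True) * tail ?N (Suc r) (Suc l) False"
    unfolding tail.simps(2)[of ?N r "Suc l"] by (simp add: left_diff_distrib del: tail.simps)
  also have "?N r False False - ?N r False True = q powi m r * (z - c r) * hop q (z / q) (c r) (d r) (k r) (m r)"
    using hop_shift[OF cd _ z, of "m r" "k r"] Suc.prems(2)[of r]
    by (simp add: pieri_branch_mat_def pieri_wt_def)
  also have "tail ?N (Suc r) (Suc l) False = z * (\<Prod>i\<in>{Suc r..<Suc r + l}. z - c i) *
      (\<Prod>i\<in>{Suc r..<Suc (Suc r + l)}. q powi m i * hop q (z / q) (c i) (d i) (k i) (m i))"
    by (rule Suc.IH) (use Suc.prems in auto)
  finally show ?case
    by (subst (1 2) prod.atLeast_Suc_lessThan) (simp_all add: mult_ac)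
qed

text \<open>
  The row vector on the left is \<open>- q^(-lam 1) / z\<close> times the first row of the gauge matrix at \<open>x = z\<close>, so
  the left-hand side is a multiple of a tail of the degenerate chain.  The powers \<open>q^(m r)\<close> collected from
  the rows telescope to \<open>q^(lam 1)\<close> and cancel that factor.
\<close>

lemma eigen_coefficient:
  assumes adm: "nonresonant q (Suc n) c d" and lam: "lam \<in> partitions (Suc n)" and z: "z \<noteq> 0"
    and cn: "c (Suc n) = 0" and kap: "\<And>i. i > n \<Longrightarrow> kap i = 0"
  defines "m \<equiv> \<lambda>r. int (lam r) - int (lam (Suc r))"
  defines "M \<equiv> branch_pieri_mat q z z c d (\<lambda>r. int (lam r) - int (kap r)) m"
  shows "hop q z (c (Suc n)) (d (Suc n)) (m (Suc n)) (m (Suc n)) *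
      ((q powi (- int (kap 1)) * (c 1 / z) - q powi (- int (lam 1))) * tail M 1 n False +
       (q powi (1 - int (kap 1)) - q powi (- int (lam 1))) * tail M 1 n True) =
    - ((\<Prod>r=1..n. z - c r) * skew_prod q (Suc n) lam kap (z / q) c d)"
proof -
  define k where "k r = int (lam r) - int (kap r)" for r
  let ?H = "hop q z (c (1 + n)) (d (1 + n)) (m (1 + n)) (m (1 + n))"
  have m: "m r \<ge> 0" if "1 \<le> r" for r
    using lam that by (auto simp: m_def partitions_def)
  have cd: "c s * d s * q ^ i \<noteq> 1" if "1 \<le> s" "s \<le> 1 + n" for s i
    using adm that by (auto simp: nonresonant_def)
  have last: "k (1 + n) = m (1 + n)"
    using kap[of "Suc n"] lam by (simp add: k_def m_def partitions_def)
  let ?t = "tail (pieri_branch_mat q z z c d k m) 1 (Suc n) False"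
  have t1: "?t = ?H * ((z - c 1 * q powi k 1) * tail M 1 n False + z * (1 - q * q powi k 1) * tail M 1 n True)"
    using tail_intertwine[where r = 1 and l = n and c = c and d = d and m = m and k = k and e = False and z = z, OF cd m z last]
    unfolding M_def k_def[abs_def] by (simp only: gauge_def if_False if_True)
  have tel: "(\<Prod>i\<in>{1..<Suc (1 + l)}. q powi m i) = q powi (int (lam 1) - int (lam (Suc (Suc l))))" for l
  proof (induction l)
    case (Suc l)
    have "(\<Prod>i\<in>{1..<Suc (1 + Suc l)}. q powi m i) = (\<Prod>i\<in>{1..<Suc (1 + l)}. q powi m i) * q powi m (Suc (Suc l))"
      by simp
    then show ?case unfolding Suc by (simp add: m_def q0 flip: power_int_add)
  qed (simp add: m_def)
  have l0: "int (lam (Suc (Suc n))) = 0" and ivl: "{1..<Suc (1 + n)} = {1..Suc n}"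
    using lam by (auto simp: partitions_def)
  have "(\<Prod>i\<in>{1..<Suc (1 + n)}. q powi m i * hop q (z / q) (c i) (d i) (k i) (m i)) =
      q powi (int (lam 1)) * skew_prod q (Suc n) lam kap (z / q) c d"
    unfolding prod.distrib tel l0 unfolding ivl skew_prod_def k_def m_def by (simp only: diff_0_right)
  then have t2: "?t = z * (\<Prod>r=1..n. z - c r) * (q powi (int (lam 1)) * skew_prod q (Suc n) lam kap (z / q) c d)"
    using tail_degenerate[where r = 1 and l = n and c = c and d = d and m = m and k = k, OF cd m z last] cn
    by (simp add: atLeastLessThanSuc_atLeastAtMost)
  define Q where "Q = q powi (- int (lam 1))"
  have Q: "Q * q powi (int (lam 1)) = 1" using q0 by (simp add: Q_def power_int_minus)
  have Qk: "q powi (- int (kap 1)) = Q * q powi k 1" "q powi (1 - int (kap 1)) = Q * (q * q powi k 1)"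
  proof -
    have e: "- int (kap 1) = - int (lam 1) + k 1" "1 - int (kap 1) = - int (lam 1) + (1 + k 1)"
      by (simp_all add: k_def)
    show "q powi (- int (kap 1)) = Q * q powi k 1" "q powi (1 - int (kap 1)) = Q * (q * q powi k 1)"
      unfolding e Q_def by (simp_all only: power_int_add[OF disjI1[OF q0]] power_int_1_right)
  qed
  have "?H * ((Q * q powi k 1 * (c 1 / z) - Q) * tail M 1 n False + (Q * (q * q powi k 1) - Q) * tail M 1 n True) =
      - (Q / z) * ?t"
    unfolding t1 using z by (simp add: field_simps)
  also have "\<dots> = - ((Q * q powi (int (lam 1))) * ((\<Prod>r=1..n. z - c r) * skew_prod q (Suc n) lam kap (z / q) c d))"
    unfolding t2 using z by (simp add: field_simps)
  finally show ?thesis unfolding Q Qk Q_def[symmetric] by simp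
qed


lemma sqW_one:
  assumes "lam \<in> partitions 1" "c 1 = 0"
  shows "sqW q 1 lam x c d = x 1 ^ lam 1"
proof -
  have box0: "box 0 (lam 1) = {\<lambda>_. 0}"
    by (auto simp: box_def fun_eq_iff gr0_conv_Suc) (metis not0_implies_Suc zero_less_Suc)
  have "sqW q (Suc 0) lam x c d = (\<Sum>mu\<in>box 0 (lam 1). skew_prod q (Suc 0) lam mu (x (Suc 0)) c d * sqW q 0 mu x (\<lambda>i. c (Suc i)) d)"
    by (rule sqW_Suc_box) (use assms(1) partitions_le_first[OF assms(1)] in \<open>auto simp: partitions_def\<close>)
  also have "\<dots> = x 1 ^ lam 1"
    unfolding box0 using assms qpoch_q_nonzero
    by (simp add: skew_prod_def hop_def partitions_def qpoch_zero)
  finally show ?thesis by simp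
qed

text \<open>
  The induction hypothesis for the eigenrelation applies to partitions only; the other terms of a Pieri
  expansion have coefficient zero.
\<close>

lemma pieri_coef_nonzeroD:
  assumes nz: "pieri_coef q z n lam c d S \<noteq> 0" and lam: "lam \<in> partitions n" and S: "S \<subseteq> {1..n}"
  shows "add_strip lam S \<in> partitions n"
proof -
  have "add_strip lam S (Suc i) \<le> add_strip lam S i" if i: "i \<ge> 1" for i
  proof (rule ccontr)
    assume "\<not> ?thesis"
    moreover have "lam (Suc i) \<le> lam i" using lam i by (simp add: partitions_def)
    ultimately have *: "i \<notin> S" "Suc i \<in> S" "lam (Suc i) = lam i"
      by (auto simp: add_strip_def of_bool_def split: if_splits)
    then have "i \<in> {1..n}" using S i by auto
    moreover have "pieri_wt z (c i) (d i) (i \<in> S) (Suc i \<in> S) (q powi (int (lam i) - int (lam (Suc i)))) = 0"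
      using * by (simp add: pieri_wt_def)
    ultimately show False using nz unfolding pieri_coef_def by (meson finite_atLeastAtMost prod_zero)
  qed
  then show ?thesis using lam S by (auto simp: partitions_def add_strip_def)
qed

text \<open>
  The condition \<open>c n = 0\<close> is inherited by the shifted parameters.  The induction starts at one variable,
  where the polynomial is a monomial; in zero variables the difference operator is \<open>0\<close> and not \<open>1\<close>.
\<close>

lemma eigenrelation:
  assumes "n \<ge> 1" "nonresonant q n c d" "c n = 0" "lam \<in> partitions n"
    and "\<And>i. i \<in> {1..n} \<Longrightarrow> x i \<noteq> 0" "inj_on x {1..n}"
  shows "qdiff_op q n c (\<lambda>y. sqW q n lam y c d) x = q powi (- int (lam 1)) * sqW q n lam x c d"
  using assms
proof (induction n arbitrary: c lam rule: nat_induct_at_least)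
  case base
  then show ?case
    using sqW_one by (simp add: qdiff_op_def power_mult_distrib power_int_minus power_inverse)
next
  case (Suc n)
  define z where "z = x (Suc n)"
  define c' where "c' = (\<lambda>i. c (Suc i))"
  define L where "L = lam 1"
  define f where "f kap y = sqW q n kap y c' d" for kap y
  define Phi where "Phi w kap = skew_prod q (Suc n) lam kap w c d" for w kap
  define T where "T i = x(i := inverse q * x i)" for i
  define A where "A i = (\<Prod>r=1..n - 1. 1 - c' r / x i) * (\<Prod>j\<in>{1..n} - {i}. 1 / (1 - x j / x i))" for i
  define P where "P = (\<Prod>j=1..n. z - x j)"
  define E where "E kap = (\<Sum>i=1..n. A i / (x i - z) * f kap (T i))" for kap
  define W where "W kap S = pieri_coef q z n kap c' d S" for kap S
  define Q where "Q = q powi (- int (lam 1))"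
  have x0: "x i \<noteq> 0" if "i \<in> {1..n}" for i using Suc.prems(4) that by auto
  have z0: "z \<noteq> 0" using Suc.prems(4) by (simp add: z_def)
  have xz: "x i \<noteq> z" if "i \<in> {1..n}" for i
    using inj_onD[OF Suc.prems(5), of i "Suc n"] that by (auto simp: z_def)
  have P0: "P \<noteq> 0" unfolding P_def prod_zero_iff[OF finite_atLeastAtMost] using xz by (metis right_minus_eq)
  have adm: "nonresonant q n c' d" using nonresonant_shift[OF Suc.prems(1)] by (simp add: c'_def)
  have lam: "lam 0 = 0" "\<And>i. i > Suc n \<Longrightarrow> lam i = 0" "\<And>i. lam i \<le> L" "\<And>i. lam i \<le> Suc L"
    using Suc.prems(3) partitions_le_first[OF Suc.prems(3)] by (auto simp: partitions_def L_def le_SucI)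
  have branch: "sqW q (Suc n) lam y c d = (\<Sum>kap\<in>box n L. Phi (y (Suc n)) kap * f kap y)"
    "sqW q (Suc n) lam y c d = (\<Sum>kap\<in>box n (Suc L). Phi (y (Suc n)) kap * f kap y)" for y
    unfolding Phi_def f_def c'_def
    by (rule sqW_Suc_box; rule lam; assumption?)+
  have D: "(\<Sum>i=1..n. A i * f kap (T i)) = q powi (- int (kap 1)) * f kap x" if "kap \<in> partitions n" for kap
  proof -
    have "qdiff_op q n c' (\<lambda>y. f kap y) x = q powi (- int (kap 1)) * f kap x"
      unfolding f_def
      by (rule Suc.IH) (use adm Suc.prems that in \<open>auto simp: c'_def intro: inj_on_subset\<close>)
    then show ?thesis by (simp add: qdiff_op_def A_def T_def)
  qed
  have pieri_x: "P * f kap x = (\<Sum>S\<in>Pow {1..n}. W kap S * f (add_strip kap S) x)" if "kap \<in> partitions n" for kap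
    unfolding P_def f_def W_def using adm that x0 by (rule pieri)
  have pieri_T: "P * (1 / q - (1 - 1 / q) * z / (x i - z)) * f kap (T i) =
      (\<Sum>S\<in>Pow {1..n}. W kap S * f (add_strip kap S) (T i))" if kap: "kap \<in> partitions n" and i: "i \<in> {1..n}" for kap i
  proof -
    define R where "R = (\<Prod>j\<in>{1..n} - {i}. z - x j)"
    have "(\<Prod>j=1..n. z - T i j) = (z - x i / q) * R"
    proof -
      have "(\<Prod>j\<in>{1..n} - {i}. z - T i j) = R"
        unfolding R_def by (rule prod.cong) (auto simp: T_def)
      moreover have "T i i = x i / q" by (simp add: T_def field_simps)
      ultimately show ?thesis unfolding prod.remove[OF finite_atLeastAtMost i] by simp
    qed
    also have "z - x i / q = (z - x i) * (1 / q - (1 - 1 / q) * z / (x i - z))"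
      using xz[OF i] q0 by (simp add: field_simps)
    also have "\<dots> * R = ((z - x i) * R) * (1 / q - (1 - 1 / q) * z / (x i - z))"
      by (simp only: mult_ac)
    also have "(z - x i) * R = P"
      unfolding P_def R_def prod.remove[OF finite_atLeastAtMost i] ..
    finally have "P * (1 / q - (1 - 1 / q) * z / (x i - z)) = (\<Prod>j=1..n. z - T i j)" ..
    moreover have "(\<Prod>j=1..n. z - T i j) * f kap (T i) = (\<Sum>S\<in>Pow {1..n}. W kap S * f (add_strip kap S) (T i))"
      unfolding f_def W_def using adm kap by (rule pieri) (use x0 q0 in \<open>auto simp: T_def\<close>)
    ultimately show ?thesis by simp
  qed
  \<comment> \<open>Evaluate \<open>D\<close> on \<open>P f_kap\<close> in two ways: by the commutation of \<open>D\<close> with \<open>P\<close>, and termwise on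
    the Pieri expansion.\<close>
  have E: "z * P * E kap = - (q powi (- int (kap 1))) * (\<Sum>S\<in>Pow {1..n}. of_bool (1 \<notin> S) * W kap S * f (add_strip kap S) x)"
    if kap: "kap \<in> partitions n" for kap
  proof -
    define X where "X = q powi (- int (kap 1))"
    define \<delta> where "\<delta> = 1 - 1 / q"
    have "\<delta> \<noteq> 0" using q0 q1 by (auto simp: \<delta>_def)
    have "P * (1 / q * (X * f kap x) - \<delta> * z * E kap) =
        (\<Sum>i=1..n. A i * (P * (1 / q - \<delta> * z / (x i - z)) * f kap (T i)))"
      unfolding X_def D[OF kap, symmetric] E_def
      by (simp add: sum_distrib_left sum_subtractf algebra_simps)
    also have "\<dots> = (\<Sum>i=1..n. A i * (\<Sum>S\<in>Pow {1..n}. W kap S * f (add_strip kap S) (T i)))"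
      using pieri_T[OF kap] by (intro sum.cong) (auto simp: \<delta>_def)
    also have "\<dots> = (\<Sum>S\<in>Pow {1..n}. W kap S * (\<Sum>i=1..n. A i * f (add_strip kap S) (T i)))"
      by (simp only: sum_distrib_left sum.swap[of _ "{1..n}"] mult_ac)
    also have "\<dots> = (\<Sum>S\<in>Pow {1..n}. W kap S * (X * (if 1 \<in> S then 1 / q else 1) * f (add_strip kap S) x))"
    proof (rule sum.cong[OF refl])
      fix S assume S: "S \<in> Pow {1..n}"
      show "W kap S * (\<Sum>i=1..n. A i * f (add_strip kap S) (T i)) =
          W kap S * (X * (if 1 \<in> S then 1 / q else 1) * f (add_strip kap S) x)"
      proof (cases "W kap S = 0")
        case False
        then have "add_strip kap S \<in> partitions n"
          using pieri_coef_nonzeroD kap S by (auto simp: W_def)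
        moreover have "q powi (- int (add_strip kap S 1)) = X * (if 1 \<in> S then 1 / q else 1)"
          using q0 by (auto simp: X_def add_strip_def power_int_diff)
        ultimately show ?thesis using D by simp
      qed simp
    qed
    finally have "\<delta> * (z * P * E kap) = 1 / q * X * (P * f kap x) -
        (\<Sum>S\<in>Pow {1..n}. W kap S * (X * (if 1 \<in> S then 1 / q else 1) * f (add_strip kap S) x))"
      by (simp add: algebra_simps)
    also have "\<dots> = (\<Sum>S\<in>Pow {1..n}. 1 / q * X * (W kap S * f (add_strip kap S) x) -
        W kap S * (X * (if 1 \<in> S then 1 / q else 1) * f (add_strip kap S) x))"
      unfolding pieri_x[OF kap] by (simp only: sum_distrib_left sum_subtractf)
    also have "\<dots> = (\<Sum>S\<in>Pow {1..n}. \<delta> * (- X * (of_bool (1 \<notin> S) * W kap S * f (add_strip kap S) x)))"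
      by (intro sum.cong) (auto simp: \<delta>_def algebra_simps)
    also have "\<dots> = \<delta> * (- X * (\<Sum>S\<in>Pow {1..n}. of_bool (1 \<notin> S) * W kap S * f (add_strip kap S) x))"
      by (simp only: sum_distrib_left)
    finally show ?thesis unfolding mult_left_cancel[OF \<open>\<delta> \<noteq> 0\<close>] X_def .
  qed
  have coef: "(\<Prod>r=1..n. 1 - c r / x i) * (\<Prod>j\<in>{1..Suc n} - {i}. 1 / (1 - x j / x i)) =
      A i + (z - c 1) * (A i / (x i - z))" if i: "i \<in> {1..n}" for i
  proof -
    obtain n' where n': "n = Suc n'" using \<open>n \<ge> 1\<close> by (cases n) auto
    have "(\<Prod>r=1..n. 1 - c r / x i) = (1 - c 1 / x i) * (\<Prod>r=1..n - 1. 1 - c' r / x i)"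
      unfolding n' c'_def by (subst prod.atLeast_Suc_atMost) (auto simp: prod.atLeast_Suc_atMost_Suc_shift simp del: prod.cl_ivl_Suc)
    moreover have "{1..Suc n} - {i} = insert (Suc n) ({1..n} - {i})" using i by auto
    then have "(\<Prod>j\<in>{1..Suc n} - {i}. 1 / (1 - x j / x i)) = 1 / (1 - z / x i) * (\<Prod>j\<in>{1..n} - {i}. 1 / (1 - x j / x i))"
      by (simp add: z_def)
    ultimately have "(\<Prod>r=1..n. 1 - c r / x i) * (\<Prod>j\<in>{1..Suc n} - {i}. 1 / (1 - x j / x i)) =
        A i * ((1 - c 1 / x i) * (1 / (1 - z / x i)))"
      by (simp add: A_def)
    also have "(1 - c 1 / x i) * (1 / (1 - z / x i)) = 1 + (z - c 1) / (x i - z)"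
      using xz[OF i] x0[OF i] by (simp add: field_simps)
    finally show ?thesis by (simp add: algebra_simps)
  qed
  have coef_last: "P * ((\<Prod>r=1..n. 1 - c r / x (Suc n)) * (\<Prod>j\<in>{1..Suc n} - {Suc n}. 1 / (1 - x j / x (Suc n)))) =
      (\<Prod>r=1..n. z - c r)"
  proof -
    have "{1..Suc n} - {Suc n} = {1..n}" by auto
    moreover have "P * ((\<Prod>r=1..n. 1 - c r / z) * (\<Prod>j=1..n. 1 / (1 - x j / z))) = (\<Prod>r=1..n. z - c r)"
      unfolding P_def prod.distrib[symmetric]
    proof (rule prod.cong[OF refl])
      fix j assume "j \<in> {1..n}"
      then have "z - x j \<noteq> 0" using xz by (metis right_minus_eq)
      then have "1 / (1 - x j / z) = z / (z - x j)" using z0 by (simp add: field_simps)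
      moreover have "1 - c j / z = (z - c j) / z" using z0 by (simp add: field_simps)
      ultimately show "(z - x j) * ((1 - c j / z) * (1 / (1 - x j / z))) = z - c j"
        using z0 \<open>z - x j \<noteq> 0\<close> by simp
    qed
    ultimately show ?thesis by (simp add: z_def)
  qed
  \<comment> \<open>What multiplies a term of the Pieri expansion of \<open>P f_mu\<close> after \<open>D\<close> and \<open>E\<close> have been evaluated:
    \<open>q^(-k) - Q\<close>, and in addition \<open>- (1 - c 1 / z) q^(-k)\<close> when the strip misses the first row.\<close>
  define U where "U k e = (if e then q powi (- k) - Q else q powi (- k) * (c 1 / z) - Q)" for k e
  have bracket: "Phi z kap * (P * (q powi (- int (kap 1)) * f kap x) + (z - c 1) * (P * E kap) - Q * (P * f kap x)) =
      Phi z kap * (\<Sum>S\<in>Pow {1..n}. U (int (kap 1)) (1 \<in> S) * W kap S * f (add_strip kap S) x)"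
    if "kap \<in> box n L" for kap
  proof (cases "Phi z kap = 0")
    case False
    then have kap: "kap \<in> partitions n"
      unfolding Phi_def by (rule skew_prod_nonzeroD) (use lam that in \<open>auto simp: box_def\<close>)
    define X where "X = q powi (- int (kap 1))"
    have "(z - c 1) * (P * E kap) = (1 - c 1 / z) * (z * P * E kap)"
      using z0 by (simp add: field_simps)
    then have "P * (X * f kap x) + (z - c 1) * (P * E kap) - Q * (P * f kap x) =
        (X - Q) * (P * f kap x) + (1 - c 1 / z) * (- X * (\<Sum>S\<in>Pow {1..n}. of_bool (1 \<notin> S) * W kap S * f (add_strip kap S) x))"
      unfolding E[OF kap] X_def by (simp add: algebra_simps)
    also have "\<dots> = (\<Sum>S\<in>Pow {1..n}. (X - Q) * (W kap S * f (add_strip kap S) x) +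
        (1 - c 1 / z) * (- X * (of_bool (1 \<notin> S) * W kap S * f (add_strip kap S) x)))"
      unfolding pieri_x[OF kap] by (simp only: sum_distrib_left sum.distrib)
    also have "\<dots> = (\<Sum>S\<in>Pow {1..n}. U (int (kap 1)) (1 \<in> S) * W kap S * f (add_strip kap S) x)"
      by (intro sum.cong) (auto simp: U_def X_def algebra_simps)
    finally show ?thesis by (simp add: X_def)
  qed simp
  let ?op = "qdiff_op q (Suc n) c (\<lambda>y. sqW q (Suc n) lam y c d) x"
  have f_last: "f kap (T (Suc n)) = f kap x" for kap
    unfolding f_def by (rule sqW_x_cong) (auto simp: T_def)
  have T_last: "T i (Suc n) = z" if "i \<in> {1..n}" for i using that by (auto simp: T_def z_def)
  have "?op = (\<Sum>i=1..n. (A i + (z - c 1) * (A i / (x i - z))) * (\<Sum>kap\<in>box n L. Phi z kap * f kap (T i))) +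
      ((\<Prod>r=1..n. 1 - c r / x (Suc n)) * (\<Prod>j\<in>{1..Suc n} - {Suc n}. 1 / (1 - x j / x (Suc n)))) *
       (\<Sum>kap\<in>box n (Suc L). Phi (z / q) kap * f kap x)"
  proof -
    have "?op = (\<Sum>i=1..n. ((\<Prod>r=1..n. 1 - c r / x i) * (\<Prod>j\<in>{1..Suc n} - {i}. 1 / (1 - x j / x i))) * sqW q (Suc n) lam (T i) c d) +
      ((\<Prod>r=1..n. 1 - c r / x (Suc n)) * (\<Prod>j\<in>{1..Suc n} - {Suc n}. 1 / (1 - x j / x (Suc n)))) * sqW q (Suc n) lam (T (Suc n)) c d"
      unfolding qdiff_op_def T_def by (simp del: sqW.simps prod.cl_ivl_Suc)
    also have "sqW q (Suc n) lam (T (Suc n)) c d = (\<Sum>kap\<in>box n (Suc L). Phi (z / q) kap * f kap x)"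
      unfolding branch(2) f_last by (simp add: T_def z_def field_simps)
    also have "(\<Sum>i=1..n. ((\<Prod>r=1..n. 1 - c r / x i) * (\<Prod>j\<in>{1..Suc n} - {i}. 1 / (1 - x j / x i))) * sqW q (Suc n) lam (T i) c d) =
      (\<Sum>i=1..n. (A i + (z - c 1) * (A i / (x i - z))) * (\<Sum>kap\<in>box n L. Phi z kap * f kap (T i)))"
      by (intro sum.cong refl arg_cong2[where f = "(*)"] coef) (simp_all only: branch(1) T_last)
    finally show ?thesis .
  qed
  also have "(\<Sum>i=1..n. (A i + (z - c 1) * (A i / (x i - z))) * (\<Sum>kap\<in>box n L. Phi z kap * f kap (T i))) =
      (\<Sum>kap\<in>box n L. Phi z kap * ((\<Sum>i=1..n. A i * f kap (T i)) + (z - c 1) * E kap))"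
  proof -
    have "(\<Sum>i=1..n. (A i + (z - c 1) * (A i / (x i - z))) * (\<Sum>kap\<in>box n L. Phi z kap * f kap (T i))) =
        (\<Sum>kap\<in>box n L. \<Sum>i=1..n. (A i + (z - c 1) * (A i / (x i - z))) * (Phi z kap * f kap (T i)))"
      by (simp only: sum_distrib_left sum.swap[of _ "{1..n}"])
    also have "\<dots> = (\<Sum>kap\<in>box n L. Phi z kap * ((\<Sum>i=1..n. A i * f kap (T i)) + (z - c 1) * E kap))"
      unfolding E_def sum_distrib_left sum.distrib[symmetric]
      by (intro sum.cong refl) (simp add: algebra_simps)
    finally show ?thesis .
  qed
  also have "\<dots> = (\<Sum>kap\<in>box n L. Phi z kap * (q powi (- int (kap 1)) * f kap x + (z - c 1) * E kap))"
  proof (rule sum.cong[OF refl])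
    fix kap assume kap: "kap \<in> box n L"
    show "Phi z kap * ((\<Sum>i=1..n. A i * f kap (T i)) + (z - c 1) * E kap) =
        Phi z kap * (q powi (- int (kap 1)) * f kap x + (z - c 1) * E kap)"
    proof (cases "Phi z kap = 0")
      case False
      then have "kap \<in> partitions n"
        unfolding Phi_def by (rule skew_prod_nonzeroD) (use lam kap in \<open>auto simp: box_def\<close>)
      then show ?thesis by (simp only: D)
    qed simp
  qed
  finally have op: "P * ?op = P * (\<Sum>kap\<in>box n L. Phi z kap * (q powi (- int (kap 1)) * f kap x + (z - c 1) * E kap)) +
      (\<Prod>r=1..n. z - c r) * (\<Sum>kap\<in>box n (Suc L). Phi (z / q) kap * f kap x)"
    unfolding coef_last[symmetric] by (simp only: distrib_left mult.assoc)
  have "P * ?op - P * (Q * sqW q (Suc n) lam x c d) =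
      (\<Sum>kap\<in>box n L. Phi z kap * (P * (q powi (- int (kap 1)) * f kap x) + (z - c 1) * (P * E kap) - Q * (P * f kap x))) +
      (\<Prod>r=1..n. z - c r) * (\<Sum>kap\<in>box n (Suc L). Phi (z / q) kap * f kap x)"
    unfolding op branch(1)[of x] z_def[symmetric]
    by (simp add: sum_distrib_left sum_subtractf sum.distrib algebra_simps)
  also have "(\<Sum>kap\<in>box n L. Phi z kap * (P * (q powi (- int (kap 1)) * f kap x) + (z - c 1) * (P * E kap) - Q * (P * f kap x))) =
      (\<Sum>kap\<in>box n L. Phi z kap * (\<Sum>S\<in>Pow {1..n}. U (int (kap 1)) (1 \<in> S) * W kap S * f (add_strip kap S) x))"
    using bracket by (intro sum.cong refl)
  also have "\<dots> = (\<Sum>kap\<in>box n (Suc L). - ((\<Prod>r=1..n. z - c r) * Phi (z / q) kap) * f kap x)"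
    unfolding Phi_def W_def c'_def
  proof (subst branch_pieri_sum[OF lam(2,3)], assumption, intro sum.cong refl arg_cong2[where f = "(*)"])
    fix kap assume kap: "kap \<in> box n (Suc L)"
    show "hop q z (c (Suc n)) (d (Suc n)) (int (lam (Suc n)) - int (lam (Suc (Suc n)))) (int (lam (Suc n)) - int (lam (Suc (Suc n)))) *
      (U (int (kap 1)) False * tail (branch_pieri_mat q z z c d (\<lambda>r. int (lam r) - int (kap r)) (\<lambda>r. int (lam r) - int (lam (Suc r)))) 1 n False +
       U (int (kap 1) - 1) True * tail (branch_pieri_mat q z z c d (\<lambda>r. int (lam r) - int (kap r)) (\<lambda>r. int (lam r) - int (lam (Suc r)))) 1 n True) =
      - ((\<Prod>r=1..n. z - c r) * skew_prod q (Suc n) lam kap (z / q) c d)"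
      using eigen_coefficient[OF Suc.prems(1,3) z0 Suc.prems(2), of kap] kap
      by (simp add: U_def Q_def box_def)
  qed
  finally have "P * ?op = P * (Q * sqW q (Suc n) lam x c d)"
    by (simp add: sum_distrib_left sum_negf mult.assoc)
  then show ?case using P0 by (simp add: Q_def)
qed

end

section \<open>The eigenrelation for the polynomials with vanishing last parameter\<close>

theorem theorem3p2:
  fixes q :: complex and n :: nat and a b x :: "nat \<Rightarrow> complex" and lam :: "nat \<Rightarrow> nat"
  assumes "q \<noteq> 0" and "norm q < 1"
    and "n \<ge> 1"
    and "\<And>r. r \<in> {1..n - 1} \<Longrightarrow> norm (a r) < 1"
    and "\<And>r. r \<in> {1..n - 1} \<Longrightarrow> norm (b r) < 1"
    and "lam \<in> partitions n"
    and "\<And>i. i \<in> {1..n} \<Longrightarrow> x i \<noteq> 0" and "inj_on x {1..n}"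
  shows "qdiff_op q n a (\<lambda>y. sqW_f q n lam y a b) x =
    q powi (- int (lam 1)) * sqW_f q n lam x a b"
proof -
  \<comment> \<open>Of the pairs \<open>(i, j)\<close> with \<open>j \<le> i \<le> n\<close>, those that involve \<open>b n\<close> have \<open>i = n\<close>, where the first
    parameter is \<open>0\<close>.\<close>
  let ?a = "a(n := 0)"
  have "?a i * b j * q ^ e \<noteq> 1" if ij: "i \<in> {1..n}" "j \<in> {1..i}" for i j e
  proof (cases "i = n")
    case False
    then have "i \<in> {1..n - 1}" "j \<in> {1..n - 1}" using ij by auto
    then have "norm (a i) < 1" "norm (b j) \<le> 1" using assms(4,5) by (auto intro: less_imp_le)
    moreover have "norm q ^ e \<le> 1" using assms(2) by (simp add: power_le_one)
    ultimately have "norm (a i * b j * q ^ e) < 1"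
      unfolding norm_mult norm_power
      using mult_mono[of "norm (a i) * norm (b j)" "norm (a i)" "norm q ^ e" 1] mult_left_le[of "norm (b j)" "norm (a i)"]
      by simp
    then show ?thesis using False by auto
  qed simp
  then have "nonresonant q n ?a b" by (simp add: nonresonant_def)
  moreover have "qdiff_op q n a F x = qdiff_op q n ?a F x" for F
    unfolding qdiff_op_def
    by (intro sum.cong refl arg_cong2[where f = "(*)"] prod.cong) auto
  ultimately show ?thesis
    unfolding sqW_f_def using eigenrelation[of q n ?a b lam x] assms by simp
qed

end
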